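(* Let $w\in C(\mathbb{C};\mathbb{C})$ be bounded and nowhere real differentiable, and define $\varrho(z)=\sin(z)+w(z)\exp(-z)$ for $z\in\mathbb{C}$. Then $\varrho$ is nowhere real differentiable, and for all $n,m\in\mathbb{N}$ the set $\mathcal{NN}^\varrho_{n,m,n+m+1}$ is universal.
   Context: For $\varrho:\mathbb{C}\to\mathbb{C}$ and $n,m,W\in\mathbb{N}$, $\mathcal{NN}^\varrho_{n,m,W}$ denotes the set of all functions $\mathbb{C}^n\to\mathbb{C}^m$ of the form $V_L\circ\varrho^{\times W}\circ V_{L-1}\circ\cdots\circ\varrho^{\times W}\circ V_1$ with arbitrary depth $L\ge 2$, where $V_1:\mathbb{C}^n\to\mathbb{C}^W$, $V_2,\dots,V_{L-1}:\mathbb{C}^W\to\mathbb{C}^W$, $V_L:\mathbb{C}^W\to\mathbb{C}^m$ are $\mathbb{C}$-affine maps ($z\mapsto Az+b$ with complex $A,b$) and $\varrho^{\times W}$ applies $\varrho$ componentwise. A class $\mathcal{F}\subseteq C(\mathbb{C}^n;\mathbb{C}^m)$ is universal if for every $g\in C(\mathbb{C}^n;\mathbb{C}^m)$, compact $K\subseteq\mathbb{C}^n$ and $\varepsilon>0$ there is $f\in\mathcal{F}$ with $\sup_{z\in K}\|f(z)-g(z)\|<\varepsilon$. Real differentiability at $z_0$: partial derivatives $\partial_x\varrho(z_0),\partial_y\varrho(z_0)$ exist and $\lim_{h\to0}\frac{\varrho(z_0+h)-\varrho(z_0)-\partial_x\varrho(z_0)\mathrm{Re}(h)-\partial_y\varrho(z_0)\mathrm{Im}(h)}{h}=0$.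 *)

theory Defs
  imports "HOL-Analysis.Analysis"
begin

definition real_differentiable_at :: "(complex \<Rightarrow> complex) \<Rightarrow> complex \<Rightarrow> bool" where
  "real_differentiable_at \<rho> z0 \<longleftrightarrow>
     (\<exists>dx dy.
        ((\<lambda>t::real. \<rho> (z0 + of_real t)) has_vector_derivative dx) (at 0) \<and>
        ((\<lambda>t::real. \<rho> (z0 + \<i> * of_real t)) has_vector_derivative dy) (at 0) \<and>
        ((\<lambda>h. (\<rho> (z0 + h) - \<rho> z0 - dx * of_real (Re h) - dy * of_real (Im h)) / h)
           \<longlongrightarrow> 0) (at 0))"

definition nowhere_real_differentiable :: "(complex \<Rightarrow> complex) \<Rightarrow> bool" where
  "nowhere_real_differentiable \<rho> \<longleftrightarrow> (\<forall>z. \<not> real_differentiable_at \<rho> z)"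

definition act :: "(complex \<Rightarrow> complex) \<Rightarrow> complex ^ 'w \<Rightarrow> complex ^ 'w" where
  "act \<rho> x = (\<chi> i. \<rho> (x $ i))"

definition hidden_layers ::
  "(complex \<Rightarrow> complex) \<Rightarrow> ((complex ^ 'w ^ 'w) \<times> (complex ^ 'w)) list \<Rightarrow> complex ^ 'w \<Rightarrow> complex ^ 'w" where
  "hidden_layers \<rho> Hs x = foldl (\<lambda>y (A, b). act \<rho> (A *v y + b)) x Hs"

text \<open>The class NN^rho_{n,m,W}: input dimension CARD('n), output CARD('m),
  width CARD('w), arbitrary depth L = length Hs + 2 \<ge> 2.\<close>
definition NN :: "(complex \<Rightarrow> complex) \<Rightarrow> ('w::finite) itself \<Rightarrow> (complex ^ 'n \<Rightarrow> complex ^ 'm) set" where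
  "NN \<rho> (W::('w::finite) itself) =
     {(\<lambda>x. C *v hidden_layers \<rho> Hs (act \<rho> (A *v x + b)) + c) | A b Hs C c.
        (A :: complex ^ 'n ^ 'w) = A \<and> (b :: complex ^ 'w) = b \<and>
        (C :: complex ^ 'w ^ 'm) = C \<and> (c :: complex ^ 'm) = c}"

definition universal :: "(complex ^ 'n \<Rightarrow> complex ^ 'm) set \<Rightarrow> bool" where
  "universal F \<longleftrightarrow>
     (\<forall>g. continuous_on UNIV g \<longrightarrow>
        (\<forall>K. compact K \<longrightarrow> (\<forall>\<epsilon>>0. \<exists>f\<in>F. \<forall>z\<in>K. norm (f z - g z) < \<epsilon>)))"

end

theory Submission
  imports Defs "HOL-Probability.Probability" "HOL-Complex_Analysis.Complex_Analysis"
begin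

text \<open>Let V be a space of functions that is closed under locally uniform limits and affine
  substitutions and contains the activation. Averaging \<open>\<rho>(a z + b + c)\<close> over independent complex
  Gaussians a and c shows that \<open>z \<mapsto> U (\<sigma> + |z|\<^sup>2)\<close> lies in V, where U is the heat evolution of
  the activation at b as a function of time. Comparing Taylor coefficients, either \<open>|z|\<^sup>2\<^sup>k\<close> is in V, or
  at every b the heat evolution is a polynomial in time of degree less than k; in the latter case the
  activation, being its value at time 0, is a fixed linear combination of smoothed versions of itself, hence
  differentiable. So all \<open>|z|\<^sup>2\<^sup>k\<close> are in V, hence \<open>exp (|z|\<^sup>2 / (2 R))\<close>, and recentring at
  \<open>-R\<close> with \<open>R \<rightarrow> \<infinity>\<close> gives \<open>exp (Re z)\<close>. Stone--Weierstrass turns these ridge exponentials into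
  density of shallow networks. A narrow network evaluates a shallow one term by term; its identity
  connections are available since \<open>\<rho>(z + 2 \<pi> N)\<close> tends to \<open>sin z\<close>.\<close>

section \<open>Closed function spaces and parameter integrals\<close>

text \<open>The activation is only continuous, so its closure cannot be explored by differentiating
  it. Gaussian smoothing takes over that role: for a standard complex Gaussian \<open>a\<close> the
  law of \<open>a * z\<close> depends only on |z|, and variances add under convolution, so z enters
  the average only through the heat time, in which the average is holomorphic. The price is a growth
  bound on the activation.

  The target \<open>exp (Re z)\<close> is real for a reason: complex exponentials would generate
  only holomorphic functions, while the functions \<open>exp (Re (dotp a x))\<close> span a real
  algebra that separates points.

  Width n + m + 1 leaves one neuron for computing; the others must carry n inputs and m partial sums
  through the activation. Far to the right, however, the term \<open>w z * exp (- z)\<close> is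
  negligible, and the sine vanishes with slope 1 at every 2 pi N.\<close>

locale closed_function_space =
  fixes V :: "('a::euclidean_space \<Rightarrow> complex) set"
  assumes zero: "(\<lambda>_. 0) \<in> V"
    and add: "f \<in> V \<Longrightarrow> g \<in> V \<Longrightarrow> (\<lambda>z. f z + g z) \<in> V"
    and scale: "f \<in> V \<Longrightarrow> (\<lambda>z. c * f z) \<in> V"
    and closed: "(\<And>K \<epsilon>. compact K \<Longrightarrow> \<epsilon> > 0 \<Longrightarrow> \<exists>g\<in>V. \<forall>z\<in>K. norm (g z - f z) < \<epsilon>) \<Longrightarrow> f \<in> V"
begin

lemma sum: "(\<And>i. i \<in> I \<Longrightarrow> f i \<in> V) \<Longrightarrow> (\<lambda>z. \<Sum>i\<in>I. f i z) \<in> V"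
  by (induction I rule: infinite_finite_induct) (auto intro: zero add)

text \<open>Riemann sums are finite linear combinations of the \<open>F p\<close>, hence lie in
  \<open>V\<close>. Uniform continuity on box times K lets one tagged division serve all z in
  K.\<close>

lemma riemann_sum:
  fixes F :: "'p::euclidean_space \<Rightarrow> 'a \<Rightarrow> complex"
  assumes cont: "continuous_on UNIV (\<lambda>(p, z). F p z)" and mem: "\<And>p. F p \<in> V"
    and K: "compact K" and e: "e > 0"
  shows "\<exists>g\<in>V. \<forall>z\<in>K. norm (g z - integral (cbox a b) (\<lambda>p. F p z)) < e"
proof -
  let ?B = "cbox a b"
  \<comment> \<open>The \<open>+ 1\<close> keeps the denominator positive for a degenerate box and
    makes the final bound strict.\<close>
  define \<eta> where "\<eta> = e / (measure lborel ?B + 1)"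
  have \<eta>: "\<eta> > 0" using e by (simp add: \<eta>_def add_nonneg_pos)
  have "uniformly_continuous_on (?B \<times> K) (\<lambda>(p, z). F p z)"
    by (intro compact_uniformly_continuous compact_Times K continuous_on_subset[OF cont]) auto
  then obtain \<delta> where \<delta>: "\<delta> > 0" and
    uc: "\<And>x y. x \<in> ?B \<times> K \<Longrightarrow> y \<in> ?B \<times> K \<Longrightarrow> dist y x < \<delta> \<Longrightarrow>
        dist ((\<lambda>(p, z). F p z) y) ((\<lambda>(p, z). F p z) x) < \<eta>"
    unfolding uniformly_continuous_on_def using \<eta> by metis
  obtain D where D: "D tagged_division_of ?B" "(\<lambda>x. ball x \<delta>) fine D"
    using fine_division_exists[OF gauge_ball[OF \<delta>], of a b] by blast
  define g where "g z = (\<Sum>(x,k)\<in>D. of_real (measure lborel k) * F x z)" for z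
  have "g \<in> V"
    unfolding g_def case_prod_unfold by (intro sum scale mem)
  moreover have "norm (g z - integral ?B (\<lambda>p. F p z)) < e" if z: "z \<in> K" for z
  proof -
    have contz: "continuous_on S (\<lambda>p. F p z)" for S
    proof -
      have "continuous_on UNIV ((\<lambda>(p, z). F p z) \<circ> (\<lambda>p. (p, z)))"
        by (intro continuous_on_compose continuous_on_subset[OF cont] continuous_intros) auto
      then show ?thesis by (auto simp: o_def intro: continuous_on_subset)
    qed
    have int: "integral ?B (\<lambda>p. F p z) = (\<Sum>(x,k)\<in>D. integral k (\<lambda>p. F p z))"
      by (rule integral_combine_tagged_division_topdown[OF integrable_continuous[OF contz] D(1)])
    have "norm (g z - integral ?B (\<lambda>p. F p z))
        = norm (\<Sum>(x,k)\<in>D. of_real (measure lborel k) * F x z - integral k (\<lambda>p. F p z))"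
      by (simp add: g_def int sum_subtractf case_prod_unfold)
    also have "\<dots> \<le> (\<Sum>(x,k)\<in>D. \<eta> * measure lborel k)"
    proof (rule sum_norm_le, clarify)
      fix x k assume xk: "(x, k) \<in> D"
      obtain u v where k: "k = cbox u v" using D(1) xk by blast
      have kB: "k \<subseteq> ?B" "x \<in> k" using D(1) xk by (auto dest: tagged_division_ofD)
      have "of_real (measure lborel k) * F x z - integral k (\<lambda>p. F p z) = integral k (\<lambda>p. F x z - F p z)"
        unfolding k by (subst Henstock_Kurzweil_Integration.integral_diff)
          (auto simp: scaleR_conv_of_real intro: integrable_continuous contz)
      moreover have "norm (integral k (\<lambda>p. F x z - F p z)) \<le> \<eta> * measure lborel k"
        unfolding k
      proof (rule has_integral_bound[OF less_imp_le[OF \<eta>] integrable_integral])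
        show "(\<lambda>p. F x z - F p z) integrable_on cbox u v"
          by (intro integrable_diff integrable_continuous contz continuous_intros)
        fix p assume "p \<in> cbox u v"
        then have "p \<in> k" by (simp add: k)
        moreover have "k \<subseteq> ball x \<delta>" using D(2) xk by (auto simp: fine_def)
        ultimately show "norm (F x z - F p z) \<le> \<eta>"
          using uc[of "(x, z)" "(p, z)"] kB z
          by (force simp: dist_norm norm_minus_commute dist_Pair_Pair)
      qed
      ultimately show "norm (of_real (measure lborel k) * F x z - integral k (\<lambda>p. F p z)) \<le> \<eta> * measure lborel k"
        by simp
    qed
    also have "\<dots> = \<eta> * measure lborel ?B"
      using additive_content_tagged_division[OF D(1)]
      by (simp add: case_prod_unfold flip: sum_distrib_left)
    also have "\<dots> < e"
      unfolding \<eta>_def using e measure_nonneg[of lborel ?B] by (subst times_divide_eq_left, subst pos_divide_less_eq) (auto simp: algebra_simps add_pos_nonneg)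
    finally show ?thesis .
  qed
  ultimately show ?thesis by blast
qed

text \<open>Truncation to growing boxes reduces this to \<open>riemann_sum\<close>; the integrable
  majorant makes the discarded tail small uniformly on K. The majorant may depend on K, because in
  the applications the growth of the integrand in p depends on the size of z.\<close>

lemma parameter_integral:
  fixes F :: "'p::euclidean_space \<Rightarrow> 'a \<Rightarrow> complex"
  assumes cont: "continuous_on UNIV (\<lambda>(p, z). F p z)" and mem: "\<And>p. F p \<in> V"
    and dom: "\<And>K. compact K \<Longrightarrow>
      \<exists>D::'p \<Rightarrow> real. integrable lborel D \<and> (\<forall>p. \<forall>z\<in>K. norm (F p z) \<le> D p)"
  shows "(\<lambda>z. \<integral>p. F p z \<partial>lborel) \<in> V"
proof (rule closed)
  fix K :: "'a set" and e :: real
  assume K: "compact K" and e: "e > 0"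
  obtain D' :: "'p \<Rightarrow> real" where D': "integrable lborel D'" "\<And>p z. z \<in> K \<Longrightarrow> norm (F p z) \<le> D' p"
    using dom[OF K] by blast
  \<comment> \<open>For empty K nothing forces \<open>D'\<close> to be nonnegative; the absolute
    value repairs this.\<close>
  define D where "D p = \<bar>D' p\<bar>" for p
  have D: "integrable lborel D" "\<And>p z. z \<in> K \<Longrightarrow> norm (F p z) \<le> D p" "\<And>p. D p \<ge> 0"
    unfolding D_def using D' by (auto intro: integrable_abs order_trans[OF _ abs_ge_self])
  define B :: "nat \<Rightarrow> 'p set" where "B n = cbox (- real n *\<^sub>R One) (real n *\<^sub>R One)" for n
  have meas[measurable]: "B n \<in> sets borel" for n by (simp add: B_def)
  have [measurable]: "D \<in> borel_measurable borel" using D(1) by (auto simp: borel_measurable_integrable)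
  have "(\<lambda>n. \<integral>p. D p * indicator (- B n) p \<partial>lborel) \<longlonglongrightarrow> integral\<^sup>L (lborel :: 'p measure) (\<lambda>_. 0)"
  proof (rule integral_dominated_convergence[where w = D])
    show "AE p in lborel. (\<lambda>n. D p * indicator (- B n) p) \<longlonglongrightarrow> 0"
    proof (intro AE_I2 tendsto_eventually)
      fix p :: 'p
      obtain N where N: "real N > norm p" using reals_Archimedean2 by blast
      have "D p * indicator (- B n) p = 0" if "n \<ge> N" for n
      proof -
        have "\<bar>p \<bullet> i\<bar> \<le> real n" if "i \<in> Basis" for i
          using Basis_le_norm[OF that, of p] N \<open>n \<ge> N\<close> by linarith
        then have "p \<in> B n" by (force simp: B_def mem_box abs_le_iff)
        then show ?thesis by simp
      qed
      then show "\<forall>\<^sub>F n in sequentially. D p * indicator (- B n) p = 0"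
        by (auto simp: eventually_sequentially)
    qed
  qed (use D in \<open>auto simp: indicator_def\<close>)
  then have "\<forall>\<^sub>F n in sequentially. (\<integral>p. D p * indicator (- B n) p \<partial>lborel) < e / 2"
    using e by (intro order_tendstoD) auto
  then obtain n where n: "(\<integral>p. D p * indicator (- B n) p \<partial>lborel) < e / 2"
    using eventually_happens'[OF sequentially_bot] by blast
  obtain g where g: "g \<in> V" "\<And>z. z \<in> K \<Longrightarrow> norm (g z - integral (B n) (\<lambda>p. F p z)) < e / 2"
    using riemann_sum[OF cont mem K, of "e/2"] e unfolding B_def by (meson half_gt_zero)
  have "norm (g z - (\<integral>p. F p z \<partial>lborel)) < e" if z: "z \<in> K" for z
  proof -
    have contz: "continuous_on UNIV (\<lambda>p. F p z)"
    proof -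
      have "continuous_on UNIV ((\<lambda>(p, z). F p z) \<circ> (\<lambda>p. (p, z)))"
        by (intro continuous_on_compose continuous_on_subset[OF cont] continuous_intros) auto
      then show ?thesis by (auto simp: o_def)
    qed
    then have [measurable]: "(\<lambda>p. F p z) \<in> borel_measurable borel"
      by (rule borel_measurable_continuous_onI)
    have intF: "integrable lborel (\<lambda>p. F p z)"
      by (rule Bochner_Integration.integrable_bound[OF D(1)]) (use D z in auto)
    have s: "set_integrable lborel (B n) (\<lambda>p. F p z)"
      unfolding set_integrable_def using integrable_mult_indicator[OF _ intF, of "B n"] by simp
    have "(\<integral>p. F p z \<partial>lborel) =
        (\<integral>p. indicator (B n) p *\<^sub>R F p z + indicator (- B n) p *\<^sub>R F p z \<partial>lborel)"
      by (intro Bochner_Integration.integral_cong) (auto simp: indicator_def)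
    also have "\<dots> = (\<integral>p. indicator (B n) p *\<^sub>R F p z \<partial>lborel) + (\<integral>p. indicator (- B n) p *\<^sub>R F p z \<partial>lborel)"
      by (intro Bochner_Integration.integral_add integrable_mult_indicator intF) auto
    also have "(\<integral>p. indicator (B n) p *\<^sub>R F p z \<partial>lborel) = integral (B n) (\<lambda>p. F p z)"
      using set_borel_integral_eq_integral(2)[OF s] by (simp add: set_lebesgue_integral_def)
    finally have "norm (g z - (\<integral>p. F p z \<partial>lborel)) \<le>
       norm (g z - integral (B n) (\<lambda>p. F p z)) + norm (\<integral>p. indicator (- B n) p *\<^sub>R F p z \<partial>lborel)"
      by (metis diff_diff_eq norm_triangle_ineq4)
    moreover have "norm (\<integral>p. indicator (- B n) p *\<^sub>R F p z \<partial>lborel) \<le> (\<integral>p. D p * indicator (- B n) p \<partial>lborel)"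
    proof (rule Bochner_Integration.integral_norm_bound_integral)
      show "integrable lborel (\<lambda>p. D p * indicator (- B n) p)"
        by (rule Bochner_Integration.integrable_bound[OF D(1)]) (auto simp: indicator_def)
      show "integrable lborel (\<lambda>p. indicator (- B n) p *\<^sub>R F p z)"
        by (intro integrable_mult_indicator intF) auto
    qed (use D z in \<open>auto simp: indicator_def\<close>)
    ultimately show ?thesis using g(2)[OF z] n by linarith
  qed
  then show "\<exists>g\<in>V. \<forall>z\<in>K. norm (g z - (\<integral>p. F p z \<partial>lborel)) < e"
    using g(1) by blast
qed

end

text \<open>Taking the continuous functions as \<open>V\<close> turns membership results into
  continuity results; the continuity of \<open>heat f s\<close> is obtained in this way.\<close>

lemma closed_function_space_continuous:
  "closed_function_space {f :: 'a::euclidean_space \<Rightarrow> complex. continuous_on UNIV f}"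
proof
  fix f :: "'a \<Rightarrow> complex"
  assume f: "\<And>K \<epsilon>. compact K \<Longrightarrow> \<epsilon> > 0 \<Longrightarrow> \<exists>g\<in>{f. continuous_on UNIV f}. \<forall>z\<in>K. norm (g z - f z) < \<epsilon>"
  have "continuous_on (ball x 1) f" for x
  proof -
    have "\<exists>g. continuous_on UNIV g \<and> (\<forall>z\<in>cball x 1. norm (g z - f z) < 1 / Suc n)" for n
      using f[of "cball x 1" "1 / Suc n"] by auto
    then obtain g where g: "\<And>n. continuous_on UNIV (g n)" "\<And>n z. z \<in> cball x 1 \<Longrightarrow> norm (g n z - f z) < 1 / Suc n"
      by metis
    have "uniform_limit (cball x 1) g f sequentially"
    proof (rule uniform_limitI)
      fix e :: real assume "e > 0"
      then obtain N where N: "1 / real (Suc N) < e" using nat_approx_posE by blast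
      have "\<forall>z\<in>cball x 1. dist (g n z) (f z) < e" if "n \<ge> N" for n
      proof
        fix z assume "z \<in> cball x 1"
        then have "dist (g n z) (f z) < 1 / Suc n" using g(2) by (simp add: dist_norm)
        also have "\<dots> \<le> 1 / Suc N" using that by (simp add: field_simps)
        finally show "dist (g n z) (f z) < e" using N by simp
      qed
      then show "\<forall>\<^sub>F n in sequentially. \<forall>z\<in>cball x 1. dist (g n z) (f z) < e"
        by (auto simp: eventually_sequentially)
    qed
    then have "continuous_on (cball x 1) f"
      by (rule uniform_limit_theorem[rotated]) (auto intro: always_eventually continuous_on_subset[OF g(1)])
    then show ?thesis by (rule continuous_on_subset) auto
  qed
  then have "isCont f x" for x
    using continuous_on_interior[of "ball x 1" f x] by auto
  then show "f \<in> {f. continuous_on UNIV f}"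
    by (simp add: continuous_at_imp_continuous_on)
qed (auto intro: continuous_on_add continuous_on_mult_left)

section \<open>Gaussian integrals\<close>

lemma gaussian_real:
  fixes l x0 :: real
  assumes "l > 0"
  shows "integrable lborel (\<lambda>x. exp (- l * (x - x0)\<^sup>2))"
    and "(\<integral>x. exp (- l * (x - x0)\<^sup>2) \<partial>lborel) = sqrt (pi / l)"
proof -
  define s where "s = sqrt (1 / (2 * l))"
  have s: "s > 0" "s\<^sup>2 = 1 / (2 * l)" using assms by (auto simp: s_def)
  have eq: "exp (- l * (x - x0)\<^sup>2) = sqrt (pi / l) * normal_density x0 s x" for x
    using assms s by (simp add: normal_density_def s(2) field_simps)
  show "integrable lborel (\<lambda>x. exp (- l * (x - x0)\<^sup>2))"
    unfolding eq using s by (intro integrable_mult_right integrable_normal_density) auto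
  show "(\<integral>x. exp (- l * (x - x0)\<^sup>2) \<partial>lborel) = sqrt (pi / l)"
    unfolding eq using s integral_normal_density[of s x0] by simp
qed

text \<open>The nonnegative integral factorises over the real and imaginary coordinates, and its
  finiteness then gives integrability.\<close>

lemma gaussian_complex:
  fixes l :: real and a :: complex
  assumes "l > 0"
  shows "integrable lborel (\<lambda>c. exp (- l * (cmod (c - a))\<^sup>2))"
    and "(\<integral>c. exp (- l * (cmod (c - a))\<^sup>2) \<partial>lborel) = pi / l"
proof -
  have eq: "exp (- l * (cmod (c - a))\<^sup>2) = (\<Prod>b\<in>Basis. exp (- l * (c \<bullet> b - a \<bullet> b)\<^sup>2))" for c
    by (simp add: Basis_complex_def cmod_power2 algebra_simps flip: exp_add)
  have nn1: "(\<integral>\<^sup>+x. ennreal (exp (- l * (x - x0)\<^sup>2)) \<partial>lborel) = ennreal (sqrt (pi / l))" for x0 :: real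
    using gaussian_real[OF assms, of x0] by (subst nn_integral_eq_integral) auto
  have "(\<integral>\<^sup>+c. ennreal (exp (- l * (cmod (c - a))\<^sup>2)) \<partial>lborel)
      = (\<integral>\<^sup>+c. (\<Prod>b\<in>Basis. ennreal (exp (- l * (c \<bullet> b - a \<bullet> b)\<^sup>2))) \<partial>lborel)"
    unfolding eq by (subst prod_ennreal) auto
  also have "\<dots> = (\<Prod>b\<in>Basis. (\<integral>\<^sup>+x. ennreal (exp (- l * (x - a \<bullet> b)\<^sup>2)) \<partial>lborel))"
    using nn_integral_lborel_prod[of "\<lambda>b x. ennreal (exp (- l * (x - a \<bullet> b)\<^sup>2))"] by simp
  also have "\<dots> = ennreal (sqrt (pi / l)) ^ 2"
    unfolding nn1 by (simp add: prod_constant)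
  also have "\<dots> = ennreal (pi / l)"
    using assms by (simp add: ennreal_power)
  finally have nn: "(\<integral>\<^sup>+c. ennreal (exp (- l * (cmod (c - a))\<^sup>2)) \<partial>lborel) = ennreal (pi / l)" .
  show "integrable lborel (\<lambda>c. exp (- l * (cmod (c - a))\<^sup>2))"
    by (rule integrableI_nonneg) (auto simp: nn[simplified])
  show "(\<integral>c. exp (- l * (cmod (c - a))\<^sup>2) \<partial>lborel) = pi / l"
    using nn assms by (subst integral_eq_nn_integral) (auto simp: nn[simplified])
qed

section \<open>Functions of at most exponential growth\<close>

definition exp_growth :: "(complex \<Rightarrow> complex) \<Rightarrow> bool" where
  "exp_growth f \<longleftrightarrow> continuous_on UNIV f \<and> (\<exists>C A. \<forall>z. norm (f z) \<le> C * exp (A * norm z))"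

lemma exp_growthI:
  assumes "continuous_on UNIV f" "\<And>z. norm (f z) \<le> C * exp (A * norm z)"
  shows "exp_growth f"
  using assms unfolding exp_growth_def by blast

lemma exp_growthE:
  assumes "exp_growth f"
  obtains C A where "continuous_on UNIV f" "C > 0" "A > 0" "\<And>z. norm (f z) \<le> C * exp (A * norm z)"
proof -
  obtain C A where *: "continuous_on UNIV f" "\<And>z. norm (f z) \<le> C * exp (A * norm z)"
    using assms unfolding exp_growth_def by blast
  have "norm (f z) \<le> (\<bar>C\<bar> + 1) * exp ((\<bar>A\<bar> + 1) * norm z)" for z
  proof -
    have "C * exp (A * norm z) \<le> (\<bar>C\<bar> + 1) * exp ((\<bar>A\<bar> + 1) * norm z)"
      by (intro mult_mono) (auto intro!: mult_right_mono)
    then show ?thesis using *(2)[of z] by linarith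
  qed
  then show ?thesis using that[of "\<bar>C\<bar> + 1" "\<bar>A\<bar> + 1"] *(1) by auto
qed

lemma exp_growth_mult:
  assumes "exp_growth f" "exp_growth g"
  shows "exp_growth (\<lambda>z. f z * g z)"
proof -
  obtain C A where f: "continuous_on UNIV f" "C > 0" "\<And>z. norm (f z) \<le> C * exp (A * norm z)"
    using exp_growthE[OF assms(1)] by blast
  obtain C' A' where g: "continuous_on UNIV g" "C' > 0" "\<And>z. norm (g z) \<le> C' * exp (A' * norm z)"
    using exp_growthE[OF assms(2)] by blast
  show ?thesis
  proof (rule exp_growthI)
    fix z
    have "norm (f z * g z) \<le> (C * exp (A * norm z)) * (C' * exp (A' * norm z))"
      unfolding norm_mult using f g by (intro mult_mono) auto
    then show "norm (f z * g z) \<le> (C * C') * exp ((A + A') * norm z)"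
      unfolding distrib_right exp_add by (simp only: mult_ac)
  qed (intro continuous_intros f g)
qed

lemma exp_growth_add:
  assumes "exp_growth f" "exp_growth g"
  shows "exp_growth (\<lambda>z. f z + g z)"
proof -
  obtain C A where f: "continuous_on UNIV f" "C > 0" "A > 0" "\<And>z. norm (f z) \<le> C * exp (A * norm z)"
    using exp_growthE[OF assms(1)] by blast
  obtain C' A' where g: "continuous_on UNIV g" "C' > 0" "A' > 0" "\<And>z. norm (g z) \<le> C' * exp (A' * norm z)"
    using exp_growthE[OF assms(2)] by blast
  show ?thesis
  proof (rule exp_growthI)
    fix z :: complex
    have "C * exp (A * norm z) \<le> C * exp ((A + A') * norm z)"
      "C' * exp (A' * norm z) \<le> C' * exp ((A + A') * norm z)"
      using f g by (auto intro!: mult_left_mono mult_right_mono)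
    then show "norm (f z + g z) \<le> (C + C') * exp ((A + A') * norm z)"
      using f(4)[of z] g(4)[of z] norm_triangle_ineq[of "f z" "g z"]
      unfolding distrib_right[of C C'] by linarith
  qed (intro continuous_intros f g)
qed

lemma exp_growth_affine:
  assumes "exp_growth f"
  shows "exp_growth (\<lambda>z. f (a * z + b))"
proof -
  obtain C A where f: "continuous_on UNIV f" "C > 0" "A > 0" "\<And>z. norm (f z) \<le> C * exp (A * norm z)"
    using exp_growthE[OF assms(1)] by blast
  show ?thesis
  proof (rule exp_growthI)
    fix z
    have "A * norm (a * z + b) \<le> (A * norm a) * norm z + A * norm b"
      using norm_triangle_ineq[of "a * z" b] f(3)
      by (metis distrib_left mult.assoc mult_le_cancel_left_pos norm_mult)
    then have "exp (A * norm (a * z + b)) \<le> exp (A * norm b) * exp ((A * norm a) * norm z)"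
      by (simp flip: exp_add add: add.commute)
    then have "C * exp (A * norm (a * z + b)) \<le> (C * exp (A * norm b)) * exp ((A * norm a) * norm z)"
      using f(2) by simp
    then show "norm (f (a * z + b)) \<le> (C * exp (A * norm b)) * exp ((A * norm a) * norm z)"
      using f(4)[of "a * z + b"] by linarith
    show "continuous_on UNIV (\<lambda>z. f (a * z + b))"
      by (intro continuous_on_compose2[OF f(1)] continuous_intros) auto
  qed
qed

lemma exp_growth_const [intro]: "exp_growth (\<lambda>_. c)"
  by (rule exp_growthI[where C = "norm c" and A = 0]) auto

lemma exp_growth_exp [intro]:
  assumes "continuous_on UNIV g" "\<And>z. norm (g z) \<le> A * norm z"
  shows "exp_growth (\<lambda>z. exp (g z))"
proof (rule exp_growthI[where C = 1 and A = A])
  fix z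
  have "norm (exp (g z)) \<le> exp (norm (g z))" by (rule norm_exp)
  also have "\<dots> \<le> exp (A * norm z)" using assms(2) by simp
  finally show "norm (exp (g z)) \<le> 1 * exp (A * norm z)" by simp
qed (intro continuous_intros assms)

lemma exp_growth_norm_power [intro]: "exp_growth (\<lambda>z. of_real (norm z ^ n))"
proof (rule exp_growthI[where C = 1 and A = "real n"])
  fix z :: complex
  have "norm z ^ n \<le> exp (norm z) ^ n"
    by (intro power_mono order_trans[OF _ exp_ge_add_one_self]) auto
  then show "norm (of_real (norm z ^ n) :: complex) \<le> 1 * exp (real n * norm z)"
    by (simp add: exp_of_nat_mult norm_power)
qed (intro continuous_intros)

text \<open>Half of the Gaussian exponent absorbs the growth: \<open>(A - l * r)^2 >= 0\<close>
  gives \<open>A * r <= A^2 / (2 * l) + (l / 2) * r^2\<close>, and the other half stays integrable.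
  This works for every width, so exponential growth of any rate is admissible.\<close>

lemma exp_growth_integrable:
  assumes "exp_growth f" "l > 0"
  shows "integrable lborel (\<lambda>c. f c * of_real (exp (- l * (cmod (c - a))\<^sup>2)))"
proof -
  obtain C A where f: "continuous_on UNIV f" "C > 0" "A > 0" "\<And>z. norm (f z) \<le> C * exp (A * norm z)"
    using exp_growthE[OF assms(1)] by blast
  have [measurable]: "f \<in> borel_measurable borel"
    using f(1) by (rule borel_measurable_continuous_onI)
  define M where "M = C * exp (A * norm a) * exp (A\<^sup>2 / (2 * l))"
  have int: "integrable lborel (\<lambda>c. M * exp (- (l / 2) * (cmod (c - a))\<^sup>2))"
    using gaussian_complex(1)[of "l / 2" a] assms(2) by auto
  show ?thesis
  proof (rule Bochner_Integration.integrable_bound[OF int])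
    show "AE c in lborel. norm (f c * of_real (exp (- l * (cmod (c - a))\<^sup>2)))
        \<le> norm (M * exp (- (l / 2) * (cmod (c - a))\<^sup>2))"
    proof (rule AE_I2)
      fix c
      define r where "r = cmod (c - a)"
      have "A * norm c \<le> A * (norm a + r)"
        using f(3) norm_triangle_ineq[of a "c - a"] by (auto simp: r_def)
      moreover have "A * r \<le> A\<^sup>2 / (2 * l) + (l / 2) * r\<^sup>2"
      proof -
        have "0 \<le> (A - l * r)\<^sup>2" by simp
        then have "2 * l * (A * r) \<le> A\<^sup>2 + l\<^sup>2 * r\<^sup>2" by (simp add: power2_eq_square algebra_simps)
        then show ?thesis using assms(2) by (simp add: field_simps power2_eq_square)
      qed
      ultimately have le: "A * norm c + (- l * r\<^sup>2) \<le> (A * norm a + A\<^sup>2 / (2 * l)) + (- (l / 2) * r\<^sup>2)"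
        by (simp add: algebra_simps)
      have "norm (f c) * exp (- l * r\<^sup>2) \<le> C * exp (A * norm c) * exp (- l * r\<^sup>2)"
        by (intro mult_right_mono f(4)) simp
      also have "\<dots> = C * exp (A * norm c + (- l * r\<^sup>2))" by (simp only: exp_add mult.assoc)
      also have "\<dots> \<le> C * exp ((A * norm a + A\<^sup>2 / (2 * l)) + (- (l / 2) * r\<^sup>2))"
        using le f(2) by (intro mult_left_mono) auto
      also have "\<dots> = M * exp (- (l / 2) * r\<^sup>2)" by (simp only: M_def exp_add mult.assoc)
      finally show "norm (f c * of_real (exp (- l * (cmod (c - a))\<^sup>2)))
        \<le> norm (M * exp (- (l / 2) * (cmod (c - a))\<^sup>2))"
        using f(2) by (simp add: norm_mult r_def M_def)
    qed
  qed simp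
qed

text \<open>A quadratic remainder whose exponential weight a Gaussian can absorb: this is what
  justifies differentiation under the integral sign below.\<close>

lemma norm_exp_minus_linear_le:
  "norm (exp z - 1 - z) \<le> (norm z)\<^sup>2 * exp (norm z)" for z :: complex
proof -
  have "norm (exp z - (\<Sum>k\<le>1. z ^ k / fact k)) \<le> exp \<bar>Re z\<bar> * norm z ^ Suc 1 / fact 1"
    by (rule Taylor_exp)
  moreover have "exp \<bar>Re z\<bar> \<le> exp (norm z)" by (simp add: abs_Re_le_cmod)
  then have "exp \<bar>Re z\<bar> * (norm z)\<^sup>2 \<le> (norm z)\<^sup>2 * exp (norm z)"
    unfolding mult.commute[of "(norm z)\<^sup>2"] by (rule mult_right_mono) simp
  ultimately show ?thesis by (simp add: power2_eq_square algebra_simps)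
qed

text \<open>The difference quotient is estimated under the integral. The parameter \<open>l\<close>
  is the inverse of the heat time, so analyticity in time comes from the kernel alone and asks no
  smoothness of \<open>f\<close>.\<close>

lemma gaussian_laplace_holomorphic:
  assumes f: "exp_growth f"
  shows "(\<lambda>l. \<integral>c. f c * exp (- l * of_real ((cmod c)\<^sup>2)) \<partial>lborel) holomorphic_on {l. Re l > 0}"
proof -
  define L where "L l = (\<integral>c. f c * exp (- l * of_real ((cmod c)\<^sup>2)) \<partial>lborel)" for l
  have [measurable]: "f \<in> borel_measurable borel"
    using f by (auto elim!: exp_growthE intro: borel_measurable_continuous_onI)
  have int: "integrable lborel (\<lambda>c. g c * exp (- l * of_real ((cmod c)\<^sup>2)))"
    if g: "exp_growth g" and l: "Re l > 0" for g l
  proof (rule Bochner_Integration.integrable_bound[OF exp_growth_integrable[OF g l, of 0]])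
    have [measurable]: "g \<in> borel_measurable borel"
      using g by (auto elim!: exp_growthE intro: borel_measurable_continuous_onI)
    show "(\<lambda>c. g c * exp (- l * of_real ((cmod c)\<^sup>2))) \<in> borel_measurable lborel" by measurable
  qed (auto simp: norm_mult)
  define L' where "L' l = (\<integral>c. f c * of_real (norm c ^ 2) * exp (- l * of_real ((cmod c)\<^sup>2)) \<partial>lborel)" for l
  have "(L has_field_derivative - L' l) (at l)" if l: "Re l > 0" for l
  proof -
    \<comment> \<open>The fourth power is the square of |c|^2 from the quadratic remainder. Only
      half of \<open>Re l\<close> is kept, since for \<open>norm h < Re l / 2\<close> the other half
      pays for the factor \<open>exp (norm w)\<close>.\<close>
    define M where "M = (\<integral>c. norm (f c * of_real (norm c ^ 4) * of_real (exp (- (Re l / 2) * (cmod (c - 0))\<^sup>2))) \<partial>lborel)"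
    have fp: "exp_growth (\<lambda>c. f c * of_real (norm c ^ n))" for n
      by (intro exp_growth_mult f exp_growth_norm_power)
    have M0: "M \<ge> 0" by (simp add: M_def)
    have bound: "norm (L (l + h) - L l - h * (- L' l)) \<le> M * (norm h)\<^sup>2" if h: "norm h < Re l / 2" for h
    proof -
      have lh: "Re (l + h) > 0" using h abs_Re_le_cmod[of h] l by auto
      define R where "R c = f c * exp (- (l + h) * of_real ((cmod c)\<^sup>2)) - f c * exp (- l * of_real ((cmod c)\<^sup>2))
          + h * (f c * of_real (norm c ^ 2) * exp (- l * of_real ((cmod c)\<^sup>2)))" for c
      define Q where "Q c = norm (f c * of_real (norm c ^ 4) * of_real (exp (- (Re l / 2) * (cmod (c - 0))\<^sup>2)))" for c
      have L: "L (l + h) - L l - h * (- L' l) = integral\<^sup>L lborel R"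
        unfolding L_def L'_def R_def using int[OF f lh] int[OF f l] int[OF fp[of 2] l] by simp
      have "norm (integral\<^sup>L lborel R) \<le> (\<integral>c. (norm h)\<^sup>2 * Q c \<partial>lborel)"
      proof (rule Bochner_Integration.integral_norm_bound_integral)
        show "integrable lborel R"
          unfolding R_def using int[OF f lh] int[OF f l] int[OF fp[of 2] l] by simp
        show "integrable lborel (\<lambda>c. (norm h)\<^sup>2 * Q c)"
          unfolding Q_def
          by (intro integrable_mult_right integrable_norm exp_growth_integrable fp) (use l in simp)
        fix c :: complex
        define r where "r = (cmod c)\<^sup>2"
        have r0: "r \<ge> 0" and r4: "norm c ^ 4 = r\<^sup>2" by (auto simp: r_def simp flip: power_mult)
        define w where "w = - h * of_real r"
        have nw: "norm w = norm h * r" using r0 by (simp add: w_def norm_mult)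
        have "exp (- (l + h) * of_real r) = exp (- l * of_real r) * exp w"
          unfolding exp_add[symmetric] w_def by (rule arg_cong[where f = exp]) (simp add: algebra_simps)
        then have R: "R c = f c * exp (- l * of_real r) * (exp w - 1 - w)"
          unfolding R_def r_def[symmetric] by (simp add: w_def algebra_simps)
        have Q: "Q c = norm (f c) * r\<^sup>2 * exp (- (Re l / 2) * r)"
          unfolding Q_def r4 by (simp add: norm_mult r_def norm_power)
        have "norm (R c) = norm (f c) * exp (- Re l * r) * norm (exp w - 1 - w)"
          unfolding R by (simp add: norm_mult)
        also have "\<dots> \<le> norm (f c) * exp (- Re l * r) * ((norm w)\<^sup>2 * exp (norm w))"
          by (intro mult_left_mono norm_exp_minus_linear_le) simp
        also have "\<dots> \<le> norm (f c) * exp (- Re l * r) * ((norm w)\<^sup>2 * exp (Re l / 2 * r))"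
          unfolding nw using mult_right_mono[OF less_imp_le[OF h] r0]
          by (intro mult_left_mono) simp_all
        also have "\<dots> = (norm h)\<^sup>2 * (norm (f c) * r\<^sup>2 * (exp (- Re l * r) * exp (Re l / 2 * r)))"
          unfolding nw by (simp add: power_mult_distrib)
        also have "exp (- Re l * r) * exp (Re l / 2 * r) = exp (- (Re l / 2) * r)"
          unfolding exp_add[symmetric] by (rule arg_cong[where f = exp]) simp
        finally show "norm (R c) \<le> (norm h)\<^sup>2 * Q c" unfolding Q .
      qed
      also have "\<dots> = M * (norm h)\<^sup>2" by (simp add: M_def Q_def mult.commute)
      finally show ?thesis unfolding L .
    qed
    have "((\<lambda>h. (L (l + h) - L l) / h - (- L' l)) \<longlongrightarrow> 0) (at 0)"
    proof (rule Lim_null_comparison)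
      have "\<forall>\<^sub>F h in at 0. norm h < Re l / 2"
        using l by (auto simp: eventually_at intro!: exI[of _ "Re l / 2"])
      then show "\<forall>\<^sub>F h in at 0. norm ((L (l + h) - L l) / h - (- L' l)) \<le> M * norm h"
        using eventually_neq_at_within[of 0 0 UNIV]
      proof eventually_elim
        case (elim h)
        have "(L (l + h) - L l) / h - (- L' l) = (L (l + h) - L l - h * (- L' l)) / h"
          using elim by (simp add: field_simps)
        also have "norm \<dots> \<le> M * (norm h)\<^sup>2 / norm h"
          unfolding norm_divide using bound[OF elim(1)] by (intro divide_right_mono) auto
        finally show ?case using elim by (simp add: power2_eq_square)
      qed
      show "((\<lambda>h. M * norm h) \<longlongrightarrow> 0) (at 0)"
        by (auto intro!: tendsto_eq_intros)
    qed
    then show ?thesis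
      unfolding DERIV_def by (subst (asm) LIM_zero_iff) (simp add: mult.commute)
  qed
  then show ?thesis
    unfolding L_def[symmetric] by (auto simp: holomorphic_on_open open_halfspace_Re_gt)
qed

section \<open>The heat evolution\<close>

locale affine_function_space = closed_function_space V
  for V :: "(complex \<Rightarrow> complex) set" +
  assumes affine: "f \<in> V \<Longrightarrow> (\<lambda>z. f (a * z + b)) \<in> V"
begin

text \<open>One statement covers two averages: over translations (u = 1, v = 0, d = 1), which
  produce the heat evolution, and over complex dilations (u = 0, v = 1, d = 0), which make it
  radial.\<close>

lemma gaussian_average:
  assumes fV: "f \<in> V" and f: "exp_growth f" and l: "l > 0"
  shows "(\<lambda>z. \<integral>c. f ((u + v * c) * z + (b + d * c)) * of_real (exp (- l * (cmod (c - 0))\<^sup>2)) \<partial>lborel) \<in> V"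
proof (rule parameter_integral)
  obtain C A where C: "continuous_on UNIV f" "C > 0" "A > 0" "\<And>z. norm (f z) \<le> C * exp (A * norm z)"
    using exp_growthE[OF f] by blast
  show "continuous_on UNIV (\<lambda>(c, z). f ((u + v * c) * z + (b + d * c)) * of_real (exp (- l * (cmod (c - 0))\<^sup>2)))"
    unfolding case_prod_unfold by (intro continuous_intros continuous_on_compose2[OF C(1)]) auto
  show "(\<lambda>z. f ((u + v * c) * z + (b + d * c)) * of_real (exp (- l * (cmod (c - 0))\<^sup>2))) \<in> V" for c
    using scale[OF affine[OF fV], of "of_real (exp (- l * (cmod (c - 0))\<^sup>2))" "u + v * c" "b + d * c"]
    by (simp only: mult.commute)
  fix K :: "complex set" assume "compact K"
  then obtain B where B: "B > 0" "\<And>z. z \<in> K \<Longrightarrow> norm z \<le> B"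
    using compact_imp_bounded bounded_pos by metis
  \<comment> \<open>For z in K the argument of \<open>f\<close> has norm at most
    \<open>(norm u * B + norm b) + (norm v * B + norm d) * norm c\<close>; P and Q are these two
    coefficients times the growth rate A.\<close>
  define P where "P = A * (norm u * B + norm b)"
  define Q where "Q = A * (norm v * B + norm d)"
  define g :: "complex \<Rightarrow> complex" where "g c = of_real (C * exp P) * exp (of_real (Q * norm c))" for c
  have Q0: "Q \<ge> 0" using C B by (simp add: Q_def)
  have "exp_growth (\<lambda>c. exp (complex_of_real (Q * norm c)))"
    by (rule exp_growth_exp[where A = Q]) (auto intro!: continuous_intros simp: Q0 norm_mult)
  then have g: "exp_growth g" unfolding g_def by (intro exp_growth_mult exp_growth_const)
  show "\<exists>D. integrable lborel D \<and> (\<forall>c. \<forall>z\<in>K. norm (f ((u + v * c) * z + (b + d * c)) * of_real (exp (- l * (cmod (c - 0))\<^sup>2))) \<le> D c)"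
  proof (intro exI[of _ "\<lambda>c. norm (g c * of_real (exp (- l * (cmod (c - 0))\<^sup>2)))"] conjI allI ballI)
    show "integrable lborel (\<lambda>c. norm (g c * of_real (exp (- l * (cmod (c - 0))\<^sup>2))))"
      by (intro integrable_norm exp_growth_integrable g l)
    fix c z assume z: "z \<in> K"
    have "norm ((u + v * c) * z + (b + d * c)) \<le> norm (u + v * c) * norm z + norm (b + d * c)"
      using norm_triangle_ineq[of "(u + v * c) * z" "b + d * c"] by (simp only: norm_mult)
    also have "\<dots> \<le> (norm u + norm v * norm c) * B + (norm b + norm d * norm c)"
      using B(2)[OF z] norm_triangle_ineq[of u "v * c"] norm_triangle_ineq[of b "d * c"]
      by (intro add_mono mult_mono) (auto simp: norm_mult)
    finally have "A * norm ((u + v * c) * z + (b + d * c)) \<le> A * ((norm u + norm v * norm c) * B + (norm b + norm d * norm c))"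
      using C(3) by (intro mult_left_mono) auto
    also have "\<dots> = P + Q * norm c"
      by (simp add: P_def Q_def algebra_simps)
    finally have "exp (A * norm ((u + v * c) * z + (b + d * c))) \<le> exp P * exp (Q * norm c)"
      unfolding exp_add[symmetric] by simp
    then have "C * exp (A * norm ((u + v * c) * z + (b + d * c))) \<le> norm (g c)"
      using C(2) by (simp add: g_def norm_mult)
    then have "norm (f ((u + v * c) * z + (b + d * c))) \<le> norm (g c)"
      using C(4) order_trans by blast
    then show "norm (f ((u + v * c) * z + (b + d * c)) * of_real (exp (- l * (cmod (c - 0))\<^sup>2)))
        \<le> norm (g c * of_real (exp (- l * (cmod (c - 0))\<^sup>2)))"
      unfolding norm_mult by (rule mult_right_mono) simp
  qed
qed

end

lemma affine_function_space_continuous: "affine_function_space {f. continuous_on UNIV f}"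
proof -
  interpret closed_function_space "{f :: complex \<Rightarrow> complex. continuous_on UNIV f}"
    by (rule closed_function_space_continuous)
  show ?thesis
    by unfold_locales (auto intro!: continuous_intros intro: continuous_on_compose2)
qed

text \<open>Convolution with the density of a centred complex Gaussian whose mean square modulus is
  s, that is, the heat flow at time s / 4. In this scale multiplying a standard Gaussian by \<zeta>
  contributes exactly |\<zeta>|^2 to s.\<close>

definition heat :: "(complex \<Rightarrow> complex) \<Rightarrow> real \<Rightarrow> complex \<Rightarrow> complex" where
  "heat f s b = of_real (1 / (pi * s)) * (\<integral>c. f c * of_real (exp (- (1 / s) * (cmod (c - b))\<^sup>2)) \<partial>lborel)"

lemma exp_growth_measurable: "exp_growth f \<Longrightarrow> f \<in> borel_measurable borel"
  by (auto simp: exp_growth_def intro: borel_measurable_continuous_onI)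

lemma heat_shift:
  assumes "exp_growth f"
  shows "heat f s b = of_real (1 / (pi * s)) * (\<integral>c. f (b + c) * of_real (exp (- (1 / s) * (cmod c)\<^sup>2)) \<partial>lborel)"
proof -
  note [measurable] = exp_growth_measurable[OF assms]
  have "(\<integral>c. f c * of_real (exp (- (1 / s) * (cmod (c - b))\<^sup>2)) \<partial>lborel)
     = (\<integral>c. f c * of_real (exp (- (1 / s) * (cmod (c - b))\<^sup>2)) \<partial>(distr lborel borel ((+) b)))"
    by (simp only: lborel_distr_plus)
  also have "\<dots> = (\<integral>c. f (b + c) * of_real (exp (- (1 / s) * (cmod (b + c - b))\<^sup>2)) \<partial>lborel)"
    by (subst integral_distr) auto
  finally show ?thesis unfolding heat_def by simp
qed

text \<open>The substitution \<open>b + s * c\<close> moves time from the kernel into the argument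
  of \<open>f\<close>, so that the limit s to 0 becomes a matter of dominated convergence. The
  Jacobian is \<open>s^2\<close>, the real dimension being two.\<close>

lemma heat_scale:
  assumes "exp_growth f" "s > 0"
  shows "heat f (s\<^sup>2) b = of_real (1 / pi) * (\<integral>c. f (b + of_real s * c) * of_real (exp (- (cmod c)\<^sup>2)) \<partial>lborel)"
proof -
  note [measurable] = exp_growth_measurable[OF assms(1)]
  define h where "h c = f c * of_real (exp (- (1 / s\<^sup>2) * (cmod (c - b))\<^sup>2))" for c
  have [measurable]: "h \<in> borel_measurable borel" unfolding h_def by measurable
  have "(\<integral>c. h c \<partial>lborel) = (\<integral>c. h c \<partial>(density (distr lborel borel (\<lambda>x. b + s *\<^sub>R x)) (\<lambda>_. ennreal (s\<^sup>2))))"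
    using lborel_affine[of s b] assms(2) by (simp add: ennreal_power)
  also have "\<dots> = (\<integral>c. s\<^sup>2 *\<^sub>R h c \<partial>(distr lborel borel (\<lambda>x. b + s *\<^sub>R x)))"
    by (subst integral_density) auto
  also have "\<dots> = (\<integral>c. s\<^sup>2 *\<^sub>R h (b + s *\<^sub>R c) \<partial>lborel)"
    by (subst integral_distr) auto
  also have "\<dots> = (\<integral>c. of_real (s\<^sup>2) * (f (b + of_real s * c) * of_real (exp (- (cmod c)\<^sup>2))) \<partial>lborel)"
    using assms(2) by (intro Bochner_Integration.integral_cong)
       (auto simp: h_def scaleR_conv_of_real norm_mult power_mult_distrib)
  also have "\<dots> = of_real (s\<^sup>2) * (\<integral>c. f (b + of_real s * c) * of_real (exp (- (cmod c)\<^sup>2)) \<partial>lborel)"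
    by (rule integral_mult_right_zero)
  finally show ?thesis
    using assms(2) unfolding heat_def h_def by simp
qed

text \<open>A sequence of times suffices, since the limit will only be compared with that of a
  polynomial in time. Squares are taken to match \<open>heat_scale\<close>.\<close>

lemma heat_tendsto:
  assumes f: "exp_growth f"
  shows "(\<lambda>n. heat f ((1 / real (Suc n))\<^sup>2) b) \<longlonglongrightarrow> f b"
proof -
  note [measurable] = exp_growth_measurable[OF f]
  obtain C A where C: "continuous_on UNIV f" "C > 0" "A > 0" "\<And>z. norm (f z) \<le> C * exp (A * norm z)"
    using exp_growthE[OF f] by blast
  define G where "G c = exp (- (cmod c)\<^sup>2)" for c
  have [measurable]: "G \<in> borel_measurable borel" unfolding G_def by measurable
  define D where "D c = norm (of_real (C * exp (A * norm b)) * exp (complex_of_real (A * norm c)) * of_real (exp (- 1 * (cmod (c - 0))\<^sup>2)))" for c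
  have "exp_growth (\<lambda>c. of_real (C * exp (A * norm b)) * exp (complex_of_real (A * norm c)))"
    using C by (intro exp_growth_mult exp_growth_const exp_growth_exp[where A = A])
      (auto intro!: continuous_intros simp: norm_mult)
  then have D: "integrable lborel D"
    unfolding D_def by (intro integrable_norm exp_growth_integrable) auto
  have "(\<lambda>n. \<integral>c. f (b + of_real (1 / real (Suc n)) * c) * of_real (G c) \<partial>lborel) \<longlonglongrightarrow> (\<integral>c. f b * of_real (G c) \<partial>lborel)"
  proof (rule integral_dominated_convergence[OF _ _ D])
    show "AE c in lborel. (\<lambda>n. f (b + of_real (1 / real (Suc n)) * c) * of_real (G c)) \<longlonglongrightarrow> f b * of_real (G c)"
    proof (intro AE_I2 tendsto_mult tendsto_const)
      fix c
      have "(\<lambda>n. b + of_real (1 / real (Suc n)) * c) \<longlonglongrightarrow> b + of_real 0 * c"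
        by (intro tendsto_intros LIMSEQ_Suc[OF lim_1_over_n])
      then have "(\<lambda>n. b + of_real (1 / real (Suc n)) * c) \<longlonglongrightarrow> b" by simp
      moreover have "isCont f b" using C(1) by (simp add: continuous_on_eq_continuous_at)
      ultimately show "(\<lambda>n. f (b + of_real (1 / real (Suc n)) * c)) \<longlonglongrightarrow> f b"
        using isCont_tendsto_compose by blast
    qed
    fix n
    show "AE c in lborel. norm (f (b + of_real (1 / real (Suc n)) * c) * of_real (G c)) \<le> D c"
    proof (rule AE_I2)
      fix c
      define t where "t = 1 / real (Suc n)"
      have t: "0 \<le> t" "t \<le> 1" by (auto simp: t_def)
      have "norm (b + of_real t * c) \<le> norm b + t * norm c"
        using norm_triangle_ineq[of b "of_real t * c"] t by (simp add: norm_mult)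
      also have "\<dots> \<le> norm b + norm c" using t by (simp add: mult_left_le_one_le)
      finally have "A * norm (b + of_real t * c) \<le> A * norm b + A * norm c"
        using C(3) by (simp flip: distrib_left)
      then have "C * exp (A * norm (b + of_real t * c)) \<le> C * (exp (A * norm b) * exp (A * norm c))"
        using C(2) by (simp flip: exp_add)
      then have "norm (f (b + of_real t * c)) \<le> C * (exp (A * norm b) * exp (A * norm c))"
        using C(4) order_trans by blast
      then have "norm (f (b + of_real t * c)) * G c \<le> C * (exp (A * norm b) * exp (A * norm c)) * G c"
        by (rule mult_right_mono) (simp add: G_def)
      then show "norm (f (b + of_real (1 / real (Suc n)) * c) * of_real (G c)) \<le> D c"
        unfolding t_def using C(2) by (simp add: D_def G_def norm_mult)
    qed
  qed measurable
  then have lim: "(\<lambda>n. \<integral>c. f (b + of_real (1 / real (Suc n)) * c) * of_real (G c) \<partial>lborel) \<longlonglongrightarrow> f b * of_real pi"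
    using gaussian_complex(2)[of 1 0] by (simp add: G_def)
  have "(\<lambda>n. of_real (1 / pi) * (\<integral>c. f (b + of_real (1 / real (Suc n)) * c) * of_real (G c) \<partial>lborel))
      \<longlonglongrightarrow> of_real (1 / pi) * (f b * of_real pi)"
    by (intro tendsto_mult tendsto_const lim)
  then show ?thesis
    by (subst heat_scale[OF f]) (simp_all add: G_def)
qed

text \<open>Completing the square in \<open>a\<close> leaves a Gaussian in \<open>a\<close> times a
  Gaussian in \<open>d\<close> of the enlarged width \<open>s + |\<zeta>|^2\<close>: variances
  add.\<close>

lemma gaussian_convolution:
  fixes d \<zeta> :: complex and s :: real
  assumes s: "s > 0"
  shows "integrable lborel (\<lambda>a. exp (- (1 / s) * (cmod (d - a * \<zeta>))\<^sup>2) * exp (- 1 * (cmod (a - 0))\<^sup>2))"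
    and "(\<integral>a. exp (- (1 / s) * (cmod (d - a * \<zeta>))\<^sup>2) * exp (- 1 * (cmod (a - 0))\<^sup>2) \<partial>lborel)
      = pi * s / (s + (cmod \<zeta>)\<^sup>2) * exp (- (1 / (s + (cmod \<zeta>)\<^sup>2)) * (cmod d)\<^sup>2)"
proof -
  define T where "T = s + (cmod \<zeta>)\<^sup>2"
  have T: "T > 0" using s by (simp add: T_def add_pos_nonneg)
  \<comment> \<open>The minimiser in \<open>a\<close> of
    \<open>|d - a * \<zeta>|^2 / s + |a|^2\<close>.\<close>
  define a0 where "a0 = cnj \<zeta> * d / of_real T"
  have sq: "(1 / s) * (cmod (d - a * \<zeta>))\<^sup>2 + (cmod a)\<^sup>2 = (T / s) * (cmod (a - a0))\<^sup>2 + (1 / T) * (cmod d)\<^sup>2" for a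
  proof -
    have T': "complex_of_real T = of_real s + \<zeta> * cnj \<zeta>"
      unfolding T_def of_real_add complex_norm_square by simp
    have "complex_of_real (T * (cmod (d - a * \<zeta>))\<^sup>2 + s * T * (cmod a)\<^sup>2)
        = of_real ((cmod (of_real T * a - cnj \<zeta> * d))\<^sup>2 + s * (cmod d)\<^sup>2)"
      unfolding of_real_add of_real_mult complex_norm_square complex_cnj_diff complex_cnj_mult
        complex_cnj_complex_of_real complex_cnj_cnj T'
      by (simp add: algebra_simps)
    then have main: "T * (cmod (d - a * \<zeta>))\<^sup>2 + s * T * (cmod a)\<^sup>2 = (cmod (of_real T * a - cnj \<zeta> * d))\<^sup>2 + s * (cmod d)\<^sup>2"
      by (simp only: of_real_eq_iff)
    have "of_real T * a - cnj \<zeta> * d = of_real T * (a - a0)"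
      using T by (simp add: a0_def right_diff_distrib)
    then have "(cmod (of_real T * a - cnj \<zeta> * d))\<^sup>2 = T\<^sup>2 * (cmod (a - a0))\<^sup>2"
      using T by (simp add: norm_mult power_mult_distrib)
    with main have "(T * (cmod (d - a * \<zeta>))\<^sup>2 + s * T * (cmod a)\<^sup>2) / (s * T) = (T\<^sup>2 * (cmod (a - a0))\<^sup>2 + s * (cmod d)\<^sup>2) / (s * T)"
      by simp
    then show ?thesis
      using s T by (simp add: add_divide_distrib power2_eq_square)
  qed
  have eq: "exp (- (1 / s) * (cmod (d - a * \<zeta>))\<^sup>2) * exp (- 1 * (cmod (a - 0))\<^sup>2) =
     exp (- (1 / T) * (cmod d)\<^sup>2) * exp (- (T / s) * (cmod (a - a0))\<^sup>2)" for a
    using sq[of a] by (simp flip: exp_add)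
  have Ts: "T / s > 0" using T s by simp
  show "integrable lborel (\<lambda>a. exp (- (1 / s) * (cmod (d - a * \<zeta>))\<^sup>2) * exp (- 1 * (cmod (a - 0))\<^sup>2))"
    unfolding eq by (intro integrable_mult_right gaussian_complex(1) Ts)
  show "(\<integral>a. exp (- (1 / s) * (cmod (d - a * \<zeta>))\<^sup>2) * exp (- 1 * (cmod (a - 0))\<^sup>2) \<partial>lborel)
      = pi * s / (s + (cmod \<zeta>)\<^sup>2) * exp (- (1 / (s + (cmod \<zeta>)\<^sup>2)) * (cmod d)\<^sup>2)"
    unfolding eq integral_mult_right_zero gaussian_complex(2)[OF Ts] T_def[symmetric] by simp
qed

text \<open>For a standard complex Gaussian \<open>a\<close>, the variable
  \<open>a * \<zeta>\<close> is again Gaussian, with mean square |\<zeta>|^2 and no memory of the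
  argument of \<zeta>; averaging over it is a further step of the heat semigroup.\<close>

lemma heat_average:
  assumes f: "exp_growth f" and s: "s > 0"
  shows "(\<integral>a. heat f s (a * \<zeta> + b) * of_real (exp (- 1 * (cmod (a - 0))\<^sup>2)) \<partial>lborel)
     = of_real pi * heat f (s + (cmod \<zeta>)\<^sup>2) b"
proof -
  note [measurable] = exp_growth_measurable[OF f]
  define T where "T = s + (cmod \<zeta>)\<^sup>2"
  have T: "T > 0" using s by (simp add: T_def add_pos_nonneg)
  define K where "K c a = exp (- (1 / s) * (cmod ((c - b) - a * \<zeta>))\<^sup>2) * exp (- 1 * (cmod (a - 0))\<^sup>2)" for c a
  have Km: "(\<lambda>(c, a). K c a) \<in> borel_measurable (borel \<Otimes>\<^sub>M borel)"
    unfolding K_def by measurable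
  have K: "integrable lborel (K c)" "integral\<^sup>L lborel (K c) = pi * s / T * exp (- (1 / T) * (cmod (c - b))\<^sup>2)" for c
    unfolding K_def[abs_def] T_def by (rule gaussian_convolution[OF s])+
  have K0: "K c a \<ge> 0" for c a by (simp add: K_def)
  \<comment> \<open>For absolute integrability the inner integral over \<open>a\<close> is computed
    exactly; what remains is \<open>norm (f c)\<close> against one Gaussian of width T.\<close>
  have fK: "integrable (lborel \<Otimes>\<^sub>M lborel) (\<lambda>(c, a). f c * of_real (K c a))"
  proof (rule lborel_pair.Fubini_integrable)
    show "(\<lambda>(c, a). f c * of_real (K c a)) \<in> borel_measurable (lborel \<Otimes>\<^sub>M lborel)"
      using Km by simp
    have "integrable lborel (\<lambda>c. (pi * s / T) * norm (f c * of_real (exp (- (1 / T) * (cmod (c - b))\<^sup>2))))"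
      using T by (intro integrable_mult_right integrable_norm exp_growth_integrable f) simp
    moreover have "(pi * s / T) * norm (f c * of_real (exp (- (1 / T) * (cmod (c - b))\<^sup>2)))
       = (\<integral>a. norm (case (c, a) of (c, a) \<Rightarrow> f c * of_real (K c a)) \<partial>lborel)" for c
      using K(2)[of c] by (simp add: norm_mult K0)
    ultimately show "integrable lborel (\<lambda>c. \<integral>a. norm (case (c, a) of (c, a) \<Rightarrow> f c * of_real (K c a)) \<partial>lborel)"
      by simp
    show "AE c in lborel. integrable lborel (\<lambda>a. case (c, a) of (c, a) \<Rightarrow> f c * of_real (K c a))"
      using K(1) by (auto intro: integrable_of_real)
  qed
  have "(\<integral>a. heat f s (a * \<zeta> + b) * of_real (exp (- 1 * (cmod (a - 0))\<^sup>2)) \<partial>lborel)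
     = (\<integral>a. of_real (1 / (pi * s)) * (\<integral>c. f c * of_real (K c a) \<partial>lborel) \<partial>lborel)"
  proof (rule Bochner_Integration.integral_cong[OF refl])
    fix a
    have "(\<integral>c. f c * of_real (exp (- (1 / s) * (cmod (c - (a * \<zeta> + b)))\<^sup>2)) \<partial>lborel) * of_real (exp (- 1 * (cmod (a - 0))\<^sup>2))
      = (\<integral>c. f c * of_real (K c a) \<partial>lborel)"
      unfolding integral_mult_left_zero[symmetric]
      by (rule Bochner_Integration.integral_cong[OF refl]) (simp add: K_def algebra_simps)
    then show "heat f s (a * \<zeta> + b) * of_real (exp (- 1 * (cmod (a - 0))\<^sup>2))
       = of_real (1 / (pi * s)) * (\<integral>c. f c * of_real (K c a) \<partial>lborel)"
      unfolding heat_def by (simp only: mult.assoc)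
  qed
  also have "\<dots> = of_real (1 / (pi * s)) * (\<integral>a. (\<integral>c. f c * of_real (K c a) \<partial>lborel) \<partial>lborel)"
    by (rule integral_mult_right_zero)
  also have "(\<integral>a. (\<integral>c. f c * of_real (K c a) \<partial>lborel) \<partial>lborel) = (\<integral>c. (\<integral>a. f c * of_real (K c a) \<partial>lborel) \<partial>lborel)"
    using lborel_pair.Fubini_integral[OF fK] by simp
  also have "\<dots> = (\<integral>c. of_real (pi * s / T) * (f c * of_real (exp (- (1 / T) * (cmod (c - b))\<^sup>2))) \<partial>lborel)"
    using K(2) by (intro Bochner_Integration.integral_cong[OF refl]) simp
  also have "\<dots> = of_real (pi * s / T) * (\<integral>c. f c * of_real (exp (- (1 / T) * (cmod (c - b))\<^sup>2)) \<partial>lborel)"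
    by (rule integral_mult_right_zero)
  finally show ?thesis
    using s T unfolding heat_def T_def[symmetric] by simp
qed

lemma (in affine_function_space) heat_mem:
  assumes "f \<in> V" "exp_growth f" "s > 0"
  shows "heat f s \<in> V"
proof -
  have "(\<lambda>z. of_real (1 / (pi * s)) * (\<integral>c. f ((1 + 0 * c) * z + (0 + 1 * c)) * of_real (exp (- (1 / s) * (cmod (c - 0))\<^sup>2)) \<partial>lborel)) \<in> V"
    using assms by (intro scale gaussian_average) auto
  moreover have "(\<lambda>z. of_real (1 / (pi * s)) * (\<integral>c. f ((1 + 0 * c) * z + (0 + 1 * c)) * of_real (exp (- (1 / s) * (cmod (c - 0))\<^sup>2)) \<partial>lborel)) = heat f s"
    unfolding heat_shift[OF assms(2), abs_def] fun_eq_iff by simp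
  ultimately show ?thesis by simp
qed

lemma exp_growth_heat:
  assumes f: "exp_growth f" and s: "s > 0"
  shows "exp_growth (heat f s)"
proof -
  note [measurable] = exp_growth_measurable[OF f]
  obtain C A where C: "continuous_on UNIV f" "C > 0" "A > 0" "\<And>z. norm (f z) \<le> C * exp (A * norm z)"
    using exp_growthE[OF f] by blast
  define g where "g c = norm (exp (complex_of_real (A * norm c)) * of_real (exp (- (1 / s) * (cmod (c - 0))\<^sup>2)))" for c
  have g: "integrable lborel g"
    unfolding g_def using s C
    by (intro integrable_norm exp_growth_integrable exp_growth_exp[where A = A])
      (auto intro!: continuous_intros simp: norm_mult)
  show ?thesis
  proof (rule exp_growthI)
    \<comment> \<open>Continuity is \<open>heat_mem\<close> read in the space of continuous
      functions.\<close>
    show "continuous_on UNIV (heat f s)"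
      using affine_function_space.heat_mem[OF affine_function_space_continuous _ f s] C(1) by simp
    fix z
    have fz: "exp_growth (\<lambda>c. f (z + c))"
      using exp_growth_affine[OF f, of 1 z] by (simp add: add.commute)
    have "norm (\<integral>c. f (z + c) * of_real (exp (- (1 / s) * (cmod c)\<^sup>2)) \<partial>lborel)
       \<le> (\<integral>c. (C * exp (A * norm z)) * g c \<partial>lborel)"
    proof (rule Bochner_Integration.integral_norm_bound_integral)
      show "integrable lborel (\<lambda>c. f (z + c) * of_real (exp (- (1 / s) * (cmod c)\<^sup>2)))"
        using exp_growth_integrable[OF fz, of "1/s" 0] s by simp
      show "integrable lborel (\<lambda>c. (C * exp (A * norm z)) * g c)"
        by (intro integrable_mult_right g)
      fix c
      have "A * norm (z + c) \<le> A * norm z + A * norm c"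
        using norm_triangle_ineq[of z c] C(3) by (simp flip: distrib_left)
      then have "C * exp (A * norm (z + c)) \<le> C * exp (A * norm z) * exp (A * norm c)"
        using C(2) unfolding mult.assoc exp_add[symmetric] by simp
      then have "norm (f (z + c)) \<le> C * exp (A * norm z) * exp (A * norm c)"
        using C(4) order_trans by blast
      then have "norm (f (z + c)) * exp (- (1 / s) * (cmod c)\<^sup>2) \<le> C * exp (A * norm z) * exp (A * norm c) * exp (- (1 / s) * (cmod c)\<^sup>2)"
        by (rule mult_right_mono) simp
      then show "norm (f (z + c) * of_real (exp (- (1 / s) * (cmod c)\<^sup>2))) \<le> (C * exp (A * norm z)) * g c"
        by (simp add: g_def norm_mult mult.assoc)
    qed
    also have "\<dots> = (C * exp (A * norm z)) * integral\<^sup>L lborel g"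
      by (rule integral_mult_right_zero)
    finally have "norm (heat f s z) \<le> (1 / (pi * s)) * ((C * exp (A * norm z)) * integral\<^sup>L lborel g)"
      unfolding heat_shift[OF f] norm_mult using s by (intro mult_mono) (auto simp: norm_divide norm_mult)
    then show "norm (heat f s z) \<le> (1 / (pi * s) * C * integral\<^sup>L lborel g) * exp (A * norm z)"
      by (simp only: mult_ac)
  qed
qed

text \<open>The preliminary smoothing by \<open>s > 0\<close> puts the value z = 0 at a positive
  time, inside the half-plane where the heat evolution is holomorphic, so that an expansion in
  powers of |z|^2 becomes possible.\<close>

lemma (in affine_function_space) radial_heat_mem:
  assumes "f \<in> V" "exp_growth f" "s > 0"
  shows "(\<lambda>z. heat f (s + (cmod z)\<^sup>2) b) \<in> V"
proof -
  have "(\<lambda>z. of_real (1 / pi) * (\<integral>c. heat f s ((0 + 1 * c) * z + (b + 0 * c)) * of_real (exp (- 1 * (cmod (c - 0))\<^sup>2)) \<partial>lborel)) \<in> V"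
    using assms by (intro scale gaussian_average heat_mem exp_growth_heat) auto
  moreover have "(\<lambda>z. of_real (1 / pi) * (\<integral>c. heat f s ((0 + 1 * c) * z + (b + 0 * c)) * of_real (exp (- 1 * (cmod (c - 0))\<^sup>2)) \<partial>lborel))
     = (\<lambda>z. heat f (s + (cmod z)\<^sup>2) b)"
    using heat_average[OF assms(2,3)] by (simp add: fun_eq_iff)
  ultimately show ?thesis by simp
qed

text \<open>The evolution is \<open>1 / (pi * s)\<close> times a Laplace-type integral at
  \<open>1 / s\<close>, and inversion maps the right half-plane into itself.\<close>

lemma heat_holomorphic_extension:
  assumes f: "exp_growth f"
  obtains U where "U holomorphic_on {s. Re s > 0}" "\<And>s. s > 0 \<Longrightarrow> U (of_real s) = heat f s b"
proof
  define L where "L l = (\<integral>c. f (b + c) * exp (- l * of_real ((cmod c)\<^sup>2)) \<partial>lborel)" for l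
  have fz: "exp_growth (\<lambda>c. f (b + c))"
    using exp_growth_affine[OF f, of 1 b] by (simp add: add.commute)
  have L: "L holomorphic_on {l. Re l > 0}"
    unfolding L_def[abs_def] by (rule gaussian_laplace_holomorphic[OF fz])
  define U where "U s = (1 / (of_real pi * s)) * L (1 / s)" for s
  have "(L \<circ> (\<lambda>s. 1 / s)) holomorphic_on {s. Re s > 0}"
    by (rule holomorphic_on_compose_gen[OF _ L])
      (auto intro!: holomorphic_intros simp: Re_divide add_pos_nonneg)
  then show "U holomorphic_on {s. Re s > 0}"
    unfolding U_def[abs_def] o_def by (intro holomorphic_intros) auto
  show "U (of_real s) = heat f s b" if "s > 0" for s
  proof -
    have "L (1 / of_real s) = (\<integral>c. f (b + c) * of_real (exp (- (1 / s) * (cmod c)\<^sup>2)) \<partial>lborel)"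
      unfolding L_def by (intro Bochner_Integration.integral_cong) (auto simp: exp_of_real[symmetric])
    then show ?thesis unfolding U_def heat_shift[OF f] by simp
  qed
qed

text \<open>Dilations z to t z with t tending to 0 isolate the lowest term. Once a coefficient is
  known to lie in \<open>V\<close>, it is subtracted and the rest divided by t^2, which exposes the
  next one; no derivative in t has to be taken inside \<open>V\<close>.\<close>

lemma (in affine_function_space) radial_taylor_coefficient_mem:
  assumes hol: "g holomorphic_on ball 0 r" and r: "r > 0"
    and mem: "(\<lambda>z. g (of_real ((cmod z)\<^sup>2))) \<in> V"
  shows "(\<lambda>z. (deriv ^^ k) g 0 / fact k * of_real (cmod z ^ (2 * k))) \<in> V"
proof -
  define a where "a n = (deriv ^^ n) g 0 / fact n" for n
  \<comment> \<open>The k-th Taylor tail divided by \<open>h ^ k\<close>, with the removable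
    singularity at 0 filled by \<open>a k\<close>. Off the ball it is just the same quotient, about
    which nothing is claimed.\<close>
  define G where "G k h = (if h = 0 then a k else (g h - (\<Sum>j<k. a j * h ^ j)) / h ^ k)" for k h
  have gs: "(\<lambda>n. a n * h ^ n) sums g h" if "h \<in> ball 0 r" for h
    using holomorphic_power_series[OF hol that] by (simp add: a_def)
  have g0: "g 0 = a 0" by (simp add: a_def)
  then have G0: "G 0 h = g h" for h by (simp add: G_def)
  have G_sums: "(\<lambda>n. a (n + k) * (h - 0) ^ n) sums G k h" if h: "h \<in> ball 0 r" for k h
  proof (cases "h = 0")
    case True
    then show ?thesis using powser_sums_zero[of "\<lambda>n. a (n + k)"] by (simp add: G_def)
  next
    case False
    have "(\<lambda>n. a (n + k) * h ^ (n + k) / h ^ k) sums ((g h - (\<Sum>j<k. a j * h ^ j)) / h ^ k)"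
      by (intro sums_divide sums_split_initial_segment gs h)
    then show ?thesis using False by (simp add: G_def power_add)
  qed
  have G_cont: "isCont (G k) 0" for k
  proof -
    have "G k holomorphic_on ball 0 r"
      by (rule power_series_holomorphic[OF G_sums])
    then show ?thesis
      using r by (auto intro!: continuous_on_interior holomorphic_on_imp_continuous_on)
  qed
  have G_Suc: "G (Suc k) h = (G k h - a k) / h" if "h \<noteq> 0" for k h
    using that by (simp add: G_def diff_divide_distrib add_divide_distrib mult.commute)
  \<comment> \<open>The limit t to 0: if all dilated tails of order k lie in \<open>V\<close>,
    continuity of \<open>G k\<close> at 0 puts the k-th coefficient term there too.\<close>
  have N: "(\<lambda>z. a k * of_real (cmod z ^ (2 * k))) \<in> V"
    if M: "\<And>t::real. t > 0 \<Longrightarrow> (\<lambda>z. of_real (cmod z ^ (2 * k)) * G k (of_real (t\<^sup>2 * (cmod z)\<^sup>2))) \<in> V" for k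
  proof (rule closed)
    fix K :: "complex set" and e :: real assume "compact K" and e: "e > 0"
    then obtain B where B: "B > 0" "\<And>z. z \<in> K \<Longrightarrow> norm z \<le> B"
      using compact_imp_bounded bounded_pos by metis
    have "e / B ^ (2 * k) > 0" using e B by simp
    then obtain d where d: "d > 0" "\<And>h. norm h < d \<Longrightarrow> norm (G k h - a k) < e / B ^ (2 * k)"
      using G_cont[of k] unfolding continuous_at_eps_delta by (auto simp: dist_norm G_def)
    \<comment> \<open>Chosen so that \<open>t^2 * B^2 = d / 2\<close>: all of K is dilated into the
      disc where \<open>G k\<close> is close to \<open>a k\<close>.\<close>
    define t where "t = sqrt (d / 2) / B"
    have t: "t > 0" "t\<^sup>2 * B\<^sup>2 < d" using d B by (auto simp: t_def power_divide)
    show "\<exists>h\<in>V. \<forall>z\<in>K. norm (h z - a k * of_real (cmod z ^ (2 * k))) < e"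
    proof (intro bexI[OF _ M[OF t(1)]] ballI)
      fix z assume z: "z \<in> K"
      have "t\<^sup>2 * (cmod z)\<^sup>2 \<le> t\<^sup>2 * B\<^sup>2"
        using B(2)[OF z] by (intro mult_left_mono power_mono) auto
      then have "norm (complex_of_real (t\<^sup>2 * (cmod z)\<^sup>2)) < d"
        using t(2) unfolding norm_of_real by (subst abs_of_nonneg) (simp, linarith)
      then have le: "norm (G k (of_real (t\<^sup>2 * (cmod z)\<^sup>2)) - a k) < e / B ^ (2 * k)"
        by (rule d(2))
      have "norm (of_real (cmod z ^ (2 * k)) * G k (of_real (t\<^sup>2 * (cmod z)\<^sup>2)) - a k * of_real (cmod z ^ (2 * k)))
        = cmod z ^ (2 * k) * norm (G k (of_real (t\<^sup>2 * (cmod z)\<^sup>2)) - a k)"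
        unfolding mult.commute[of "a k"] right_diff_distrib[symmetric] norm_mult by (simp add: norm_power)
      also have "\<dots> \<le> B ^ (2 * k) * norm (G k (of_real (t\<^sup>2 * (cmod z)\<^sup>2)) - a k)"
        using B(2)[OF z] by (intro mult_right_mono power_mono) auto
      also have "\<dots> < B ^ (2 * k) * (e / B ^ (2 * k))"
        using le B(1) by (intro mult_strict_left_mono) auto
      also have "\<dots> = e" using B(1) by simp
      finally show "norm (of_real (cmod z ^ (2 * k)) * G k (of_real (t\<^sup>2 * (cmod z)\<^sup>2)) - a k * of_real (cmod z ^ (2 * k))) < e" .
    qed
  qed
  have M: "(\<lambda>z. of_real (cmod z ^ (2 * k)) * G k (of_real (t\<^sup>2 * (cmod z)\<^sup>2))) \<in> V" if "t > 0" for t k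
    using that
  proof (induction k arbitrary: t)
    case 0
    have "(\<lambda>z. g (of_real ((cmod (of_real t * z + 0))\<^sup>2))) \<in> V"
      by (rule affine[OF mem])
    then show ?case
      by (simp add: G0 norm_mult power_mult_distrib)
  next
    case (Suc k)
    \<comment> \<open>With \<open>h = t^2 * |z|^2\<close>, the recursion
      \<open>G k h - a k = h * G (Suc k) h\<close> turns this combination into the tail of order
      \<open>Suc k\<close>.\<close>
    have "(\<lambda>z. of_real (1 / t\<^sup>2) * (of_real (cmod z ^ (2 * k)) * G k (of_real (t\<^sup>2 * (cmod z)\<^sup>2)) + (- 1) * (a k * of_real (cmod z ^ (2 * k))))) \<in> V"
      by (intro scale add N Suc.IH Suc.prems)
    moreover have "of_real (1 / t\<^sup>2) * (of_real (cmod z ^ (2 * k)) * G k (of_real (t\<^sup>2 * (cmod z)\<^sup>2)) + (- 1) * (a k * of_real (cmod z ^ (2 * k))))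
       = of_real (cmod z ^ (2 * Suc k)) * G (Suc k) (of_real (t\<^sup>2 * (cmod z)\<^sup>2))" for z
    proof (cases "z = 0")
      case True
      \<comment> \<open>The case k = 0 is separate because there \<open>cmod z ^ 0 = 1\<close>; the
        left side vanishes instead through \<open>G 0 0 = a 0\<close>.\<close>
      then show ?thesis by (cases k) (auto simp: G_def)
    next
      case False
      then have h: "complex_of_real (t\<^sup>2 * (cmod z)\<^sup>2) \<noteq> 0" using Suc.prems by simp
      show ?thesis
        unfolding G_Suc[OF h] using False Suc.prems
        by (simp add: field_simps power2_eq_square)
    qed
    ultimately show ?case by simp
  qed
  show ?thesis
    using N[OF M] by (simp add: a_def)
qed

section \<open>Non-differentiable functions generate the exponential\<close>

text \<open>Dividing by h or by its norm gives quotients of equal modulus, so both notions express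
  the same limit; the partial derivatives are the values of the Frechet derivative at 1 and
  \<i>.\<close>

lemma real_differentiable_at_iff:
  "real_differentiable_at f z \<longleftrightarrow> f differentiable (at z)"
proof
  assume "real_differentiable_at f z"
  then obtain dx dy where
    lim: "((\<lambda>h. (f (z + h) - f z - dx * of_real (Re h) - dy * of_real (Im h)) / h) \<longlongrightarrow> 0) (at 0)"
    unfolding real_differentiable_at_def by blast
  have "(f has_derivative (\<lambda>h. dx * of_real (Re h) + dy * of_real (Im h))) (at z)"
    unfolding has_derivative_at
  proof
    show "bounded_linear (\<lambda>h. dx * of_real (Re h) + dy * of_real (Im h))"
      by (intro bounded_linear_add bounded_linear_const_mult bounded_linear_compose[OF bounded_linear_of_real]
          bounded_linear_Re bounded_linear_Im)
    show "(\<lambda>h. norm (f (z + h) - f z - (dx * of_real (Re h) + dy * of_real (Im h))) / norm h) \<midarrow>0\<rightarrow> 0"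
      using tendsto_norm[OF lim] by (simp add: norm_divide diff_diff_eq add.assoc)
  qed
  then show "f differentiable (at z)" by (auto simp: differentiable_def)
next
  assume "f differentiable (at z)"
  then obtain f' where f': "(f has_derivative f') (at z)" by (auto simp: differentiable_def)
  then have lin: "bounded_linear f'" by (rule has_derivative_bounded_linear)
  have rep: "f' h = f' 1 * of_real (Re h) + f' \<i> * of_real (Im h)" for h
  proof -
    have "h = Re h *\<^sub>R 1 + Im h *\<^sub>R \<i>" by (simp add: complex_eq_iff)
    then have "f' h = Re h *\<^sub>R f' 1 + Im h *\<^sub>R f' \<i>"
      using linear_add[OF bounded_linear.linear[OF lin]] linear_scale[OF bounded_linear.linear[OF lin]] by metis
    then show ?thesis by (simp add: scaleR_conv_of_real mult.commute)
  qed
  have dir: "((\<lambda>t::real. f (z + v * of_real t)) has_vector_derivative f' v) (at 0)" for v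
  proof -
    have "((\<lambda>t::real. z + v * of_real t) has_derivative (\<lambda>t. v * of_real t)) (at 0)"
      by (auto intro!: derivative_eq_intros)
    then have "((\<lambda>t::real. f (z + v * of_real t)) has_derivative (\<lambda>t. f' (v * of_real t))) (at 0)"
      using has_derivative_compose[of "\<lambda>t::real. z + v * of_real t" _ 0 UNIV f f'] f' by simp
    moreover have "f' (v * of_real t) = t *\<^sub>R f' v" for t
      using linear_scale[OF bounded_linear.linear[OF lin], of t v] by (simp add: scaleR_conv_of_real mult.commute)
    ultimately show ?thesis by (simp add: has_vector_derivative_def)
  qed
  have "((\<lambda>h. (f (z + h) - f z - f' 1 * of_real (Re h) - f' \<i> * of_real (Im h)) / h) \<longlongrightarrow> 0) (at 0)"
  proof (rule tendsto_norm_zero_cancel)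
    have "(\<lambda>h. norm (f (z + h) - f z - f' h) / norm h) \<midarrow>0\<rightarrow> 0"
      using f' by (simp add: has_derivative_at)
    moreover have "norm ((f (z + h) - f z - f' 1 * of_real (Re h) - f' \<i> * of_real (Im h)) / h)
        = norm (f (z + h) - f z - f' h) / norm h" for h
      using rep[of h] by (simp add: norm_divide diff_diff_eq add.assoc)
    ultimately show "((\<lambda>h. norm ((f (z + h) - f z - f' 1 * of_real (Re h) - f' \<i> * of_real (Im h)) / h)) \<longlongrightarrow> 0) (at 0)"
      by simp
  qed
  then show "real_differentiable_at f z"
    unfolding real_differentiable_at_def using dir[of 1] dir[of \<i>] by (intro exI[of _ "f' 1"] exI[of _ "f' \<i>"]) simp
qed

lemma has_derivative_at_zero_quadratic:
  fixes f :: "'a::real_normed_vector \<Rightarrow> 'b::real_normed_vector"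
  assumes "bounded_linear D" "\<And>h. norm h \<le> 1 \<Longrightarrow> norm (f h - f 0 - D h) \<le> M * (norm h)\<^sup>2"
  shows "(f has_derivative D) (at 0)"
  unfolding has_derivative_at
proof (intro conjI assms(1))
  show "(\<lambda>h. norm (f (0 + h) - f 0 - D h) / norm h) \<midarrow>0\<rightarrow> 0"
  proof (rule Lim_null_comparison)
    have "\<forall>\<^sub>F h::'a in at 0. norm h \<le> 1"
      by (auto simp: eventually_at intro!: exI[of _ 1])
    then show "\<forall>\<^sub>F h in at 0. norm (norm (f (0 + h) - f 0 - D h) / norm h) \<le> M * norm h"
      using eventually_neq_at_within[of 0 0 UNIV]
    proof eventually_elim
      case (elim h)
      then show ?case using assms(2)[of h] by (simp add: field_simps power2_eq_square)
    qed
    show "((\<lambda>h::'a. M * norm h) \<longlongrightarrow> 0) (at 0)"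
      by (auto intro!: tendsto_eq_intros)
  qed
qed

text \<open>Expanding \<open>|c - b|^2\<close> splits the kernel into a smooth prefactor in
  \<open>b\<close> and an integral whose only dependence on \<open>b\<close> is the exponential of a
  real-linear cross term. That integral is differentiated at 0 by the quadratic remainder
  bound.\<close>

lemma heat_differentiable_zero:
  assumes f: "exp_growth f" and s: "s > 0"
  shows "heat f s differentiable (at 0)"
proof -
  define F where "F c = f c * of_real (exp (- (1 / s) * (cmod (c - 0))\<^sup>2))" for c
  \<comment> \<open>The cross term of \<open>- |c - b|^2 / s\<close>; it is real-linear in
    \<open>b\<close>.\<close>
  define x where "x b c = (2 / s) * Re (c * cnj b)" for b c
  define J where "J b = (\<integral>c. F c * of_real (exp (x b c)) \<partial>lborel)" for b
  define X where "X = (\<integral>c. F c * of_real (2 / s * Re c) \<partial>lborel)"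
  define Y where "Y = (\<integral>c. F c * of_real (2 / s * Im c) \<partial>lborel)"
  have xle: "\<bar>x b c\<bar> \<le> (2 / s) * (norm b * norm c)" for b c
    using abs_Re_le_cmod[of "c * cnj b"] s by (simp add: x_def abs_mult norm_mult divide_right_mono mult.commute)
  have int: "integrable lborel (\<lambda>c. F c * g c)" if "exp_growth g" for g
    using exp_growth_integrable[OF exp_growth_mult[OF f that], of "1 / s" 0] s
    by (simp add: F_def mult_ac)
  have gx: "exp_growth (\<lambda>c. of_real (exp (x b c)))" for b
    unfolding exp_of_real[symmetric]
  proof (rule exp_growth_exp[where A = "2 / s * norm b"])
    show "continuous_on UNIV (\<lambda>c. complex_of_real (x b c))"
      unfolding x_def by (intro continuous_intros)
  qed (use xle in \<open>auto simp: mult.assoc\<close>)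
  have gn: "exp_growth (\<lambda>c. of_real (2 / s * L c))" if "continuous_on UNIV L" "\<And>c. \<bar>L c\<bar> \<le> norm c" for L
  proof (rule exp_growthI[where C = "2 / s" and A = 1])
    show "continuous_on UNIV (\<lambda>c. complex_of_real (2 / s * L c))"
      by (intro continuous_intros that)
    fix c
    have "\<bar>L c\<bar> \<le> exp (norm c)" using that(2)[of c] exp_ge_add_one_self[of "norm c"] by linarith
    then show "norm (complex_of_real (2 / s * L c)) \<le> 2 / s * exp (1 * norm c)"
      unfolding norm_of_real abs_mult using s by (intro mult_mono) auto
  qed
  have iRe: "integrable lborel (\<lambda>c. F c * of_real (2 / s * Re c))"
    by (intro int gn continuous_intros abs_Re_le_cmod)
  have iIm: "integrable lborel (\<lambda>c. F c * of_real (2 / s * Im c))"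
    by (intro int gn continuous_intros abs_Im_le_cmod)
  define D where "D b = X * of_real (Re b) + Y * of_real (Im b)" for b
  have ix: "integrable lborel (\<lambda>c. F c * of_real (x b c))" and D: "D b = (\<integral>c. F c * of_real (x b c) \<partial>lborel)" for b
  proof -
    have eq: "F c * of_real (x b c) = F c * of_real (2 / s * Re c) * of_real (Re b) + F c * of_real (2 / s * Im c) * of_real (Im b)" for c
      by (simp add: x_def algebra_simps)
    show "integrable lborel (\<lambda>c. F c * of_real (x b c))"
      unfolding eq by (intro Bochner_Integration.integrable_add integrable_mult_left iRe iIm)
    show "D b = (\<integral>c. F c * of_real (x b c) \<partial>lborel)"
      unfolding eq D_def X_def Y_def integral_mult_left_zero[symmetric]
      by (rule Bochner_Integration.integral_add[symmetric]) (intro integrable_mult_left iRe iIm)+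
  qed
  \<comment> \<open>Majorant of the remainder after removing the factor \<open>(norm b)^2\<close>;
    \<open>norm b <= 1\<close> bounds the exponential independently of \<open>b\<close>.\<close>
  define E where "E c = complex_of_real ((2 / s)\<^sup>2) * (of_real (norm c ^ 2) * exp (of_real (2 / s * norm c)))" for c :: complex
  have gE: "exp_growth E"
    unfolding E_def using s
    by (intro exp_growth_mult exp_growth_const exp_growth_norm_power exp_growth_exp[where A = "2 / s"])
      (auto intro!: continuous_intros simp: norm_mult norm_divide)
  define M where "M = (\<integral>c. norm (F c * E c) \<partial>lborel)"
  have "(J has_derivative D) (at 0)"
  proof (rule has_derivative_at_zero_quadratic[where M = M])
    show "bounded_linear D"
      unfolding D_def by (intro bounded_linear_add bounded_linear_const_mult
          bounded_linear_compose[OF bounded_linear_of_real] bounded_linear_Re bounded_linear_Im)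
    fix b :: complex assume b: "norm b \<le> 1"
    define R where "R c = F c * of_real (exp (x b c)) - F c * of_real (exp (x 0 c)) - F c * of_real (x b c)" for c
    have J: "J b - J 0 - D b = integral\<^sup>L lborel R"
      unfolding J_def D R_def using int[OF gx[of b]] int[OF gx[of 0]] ix[of b] by simp
    have "norm (integral\<^sup>L lborel R) \<le> (\<integral>c. (norm b)\<^sup>2 * norm (F c * E c) \<partial>lborel)"
    proof (rule Bochner_Integration.integral_norm_bound_integral)
      show "integrable lborel R"
        unfolding R_def using int[OF gx[of b]] int[OF gx[of 0]] ix[of b] by simp
      show "integrable lborel (\<lambda>c. (norm b)\<^sup>2 * norm (F c * E c))"
        by (intro integrable_mult_right integrable_norm int gE)
      fix c
      define w where "w = complex_of_real (x b c)"
      have x0: "x 0 c = 0" by (simp add: x_def)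
      have nw: "norm w \<le> (2 / s) * (norm b * norm c)" using xle by (simp add: w_def)
      have nw': "norm w \<le> 2 / s * norm c"
      proof -
        have "(2 / s) * (norm b * norm c) \<le> (2 / s) * (1 * norm c)"
          using b s by (intro mult_left_mono mult_right_mono) auto
        then show ?thesis using nw by simp
      qed
      have "R c = F c * (exp w - 1 - w)"
        unfolding R_def w_def exp_of_real[symmetric] x0 by (simp add: algebra_simps)
      then have "norm (R c) \<le> norm (F c) * ((norm w)\<^sup>2 * exp (norm w))"
        using mult_left_mono[OF norm_exp_minus_linear_le[of w] norm_ge_zero[of "F c"]] by (simp add: norm_mult)
      also have "\<dots> \<le> norm (F c) * (((2 / s) * (norm b * norm c))\<^sup>2 * exp (2 / s * norm c))"
        using nw nw' by (intro mult_left_mono mult_mono power_mono) auto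
      also have "\<dots> = (norm b)\<^sup>2 * norm (F c * E c)"
        by (simp add: E_def norm_mult norm_power norm_divide power_mult_distrib power_divide)
      finally show "norm (R c) \<le> (norm b)\<^sup>2 * norm (F c * E c)" .
    qed
    also have "\<dots> = M * (norm b)\<^sup>2" by (simp add: M_def mult.commute)
    finally show "norm (J b - J 0 - D b) \<le> M * (norm b)\<^sup>2" unfolding J .
  qed
  then have Jd: "J differentiable (at 0)" by (auto simp: differentiable_def)
  define P where "P b = complex_of_real (1 / (pi * s) * exp (- (1 / s) * ((Re b)\<^sup>2 + (Im b)\<^sup>2)))" for b
  have Pd: "P differentiable (at 0)"
  proof -
    define r where "r b = (Re b)\<^sup>2 + (Im b)\<^sup>2" for b
    have "r differentiable (at 0)"
      unfolding r_def by (intro differentiable_add differentiable_power bounded_linear_imp_differentiable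
          bounded_linear_Re bounded_linear_Im)
    moreover have "(\<lambda>y. complex_of_real (1 / (pi * s) * exp (- (1 / s) * y))) differentiable (at (r 0))"
    proof (rule differentiable_compose[OF bounded_linear_imp_differentiable[OF bounded_linear_of_real]])
      show "(\<lambda>y. 1 / (pi * s) * exp (- (1 / s) * y)) differentiable (at (r 0))"
      proof (rule field_differentiable_imp_differentiable)
        have "((\<lambda>y. 1 / (pi * s) * exp (- (1 / s) * y)) has_field_derivative
            1 / (pi * s) * (exp (- (1 / s) * r 0) * (- (1 / s)))) (at (r 0))"
          using s by (auto intro!: derivative_eq_intros)
        then show "(\<lambda>y. 1 / (pi * s) * exp (- (1 / s) * y)) field_differentiable (at (r 0))"
          by (auto simp: field_differentiable_def)
      qed
    qed
    ultimately have "(\<lambda>b. complex_of_real (1 / (pi * s) * exp (- (1 / s) * r b))) differentiable (at 0)"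
      by (rule differentiable_compose[rotated])
    then show ?thesis by (simp add: P_def[abs_def] r_def)
  qed
  have "heat f s b = P b * J b" for b
  proof -
    have "f c * of_real (exp (- (1 / s) * (cmod (c - b))\<^sup>2)) = of_real (exp (- (1 / s) * ((Re b)\<^sup>2 + (Im b)\<^sup>2))) * (F c * of_real (exp (x b c)))" for c
    proof -
      have "(cmod (c - b))\<^sup>2 = ((Re b)\<^sup>2 + (Im b)\<^sup>2) + ((cmod (c - 0))\<^sup>2 - 2 * Re (c * cnj b))"
        unfolding cmod_power2 by (simp add: power2_eq_square algebra_simps)
      then have "- (1 / s) * (cmod (c - b))\<^sup>2 = - (1 / s) * ((Re b)\<^sup>2 + (Im b)\<^sup>2) + (- (1 / s) * (cmod (c - 0))\<^sup>2 + x b c)"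
        unfolding x_def by (simp only:) (simp add: algebra_simps)
      then show ?thesis unfolding F_def by (simp only: exp_add of_real_mult mult_ac)
    qed
    then have "(\<integral>c. f c * of_real (exp (- (1 / s) * (cmod (c - b))\<^sup>2)) \<partial>lborel)
        = (\<integral>c. of_real (exp (- (1 / s) * ((Re b)\<^sup>2 + (Im b)\<^sup>2))) * (F c * of_real (exp (x b c))) \<partial>lborel)"
      by (simp only:)
    also have "\<dots> = of_real (exp (- (1 / s) * ((Re b)\<^sup>2 + (Im b)\<^sup>2))) * J b"
      unfolding J_def by (rule integral_mult_right_zero)
    finally show ?thesis
      unfolding heat_def P_def by (simp only: of_real_mult mult.assoc)
  qed
  then have "heat f s = (\<lambda>b. P b * J b)" by auto
  then show ?thesis using differentiable_mult[OF Pd Jd] by simp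
qed

text \<open>Richardson extrapolation: halving the step and subtracting removes the top coefficient.\<close>

lemma polynomial_family_differentiable_zero:
  fixes q :: "nat \<Rightarrow> complex \<Rightarrow> complex"
  assumes "\<And>s::real. 0 < s \<Longrightarrow> s < S \<Longrightarrow> (\<lambda>b. \<Sum>j\<le>k. q j b * of_real s ^ j) differentiable (at 0)"
    and "S > 0"
  shows "q 0 differentiable (at 0)"
  using assms(1)
proof (induction k arbitrary: q)
  case 0
  from 0[of "S / 2"] show ?case using assms(2) by simp
next
  case (Suc k)
  define m where "m = (2::complex) ^ Suc k"
  have m1: "m \<noteq> 1"
  proof -
    have "norm m = 2 ^ Suc k" by (simp add: m_def norm_power norm_mult)
    moreover have "(2::real) ^ Suc k > 1" by (rule one_less_power) auto
    ultimately show ?thesis by force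
  qed
  \<comment> \<open>The factor vanishes for \<open>j = Suc k\<close> and equals \<open>m - 1\<close>
    for j = 0, so the constant coefficient survives up to a nonzero factor.\<close>
  define q' where "q' j b = (m * (1 / 2) ^ j - 1) * q j b" for j b
  have "(\<lambda>b. \<Sum>j\<le>k. q' j b * of_real s ^ j) differentiable (at 0)" if s: "0 < s" "s < S" for s
  proof -
    have "(\<lambda>b. m * (\<Sum>j\<le>Suc k. q j b * of_real (s / 2) ^ j) - (\<Sum>j\<le>Suc k. q j b * of_real s ^ j)) differentiable (at 0)"
      using s by (intro differentiable_diff differentiable_mult differentiable_const Suc.prems) auto
    moreover have "m * (\<Sum>j\<le>Suc k. q j b * of_real (s / 2) ^ j) - (\<Sum>j\<le>Suc k. q j b * of_real s ^ j)
       = (\<Sum>j\<le>k. q' j b * of_real s ^ j)" for b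
    proof -
      have "m * (\<Sum>j\<le>Suc k. q j b * of_real (s / 2) ^ j) - (\<Sum>j\<le>Suc k. q j b * of_real s ^ j)
        = (\<Sum>j\<le>Suc k. q' j b * of_real s ^ j)"
        unfolding sum_distrib_left sum_subtractf[symmetric]
        by (intro sum.cong) (auto simp: q'_def power_divide algebra_simps)
      also have "q' (Suc k) b = 0" by (simp add: q'_def m_def power_divide)
      ultimately show ?thesis by simp
    qed
    ultimately show ?thesis by simp
  qed
  then have "q' 0 differentiable (at 0)" by (rule Suc.IH)
  then have "(\<lambda>b. 1 / (m - 1) * q' 0 b) differentiable (at 0)"
    by (intro differentiable_mult differentiable_const)
  moreover have "(\<lambda>b. 1 / (m - 1) * q' 0 b) = q 0"
    using m1 by (auto simp: q'_def)
  ultimately show ?case by simp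
qed

text \<open>Vanishing is known only on the positive half-line, the actual heat times. That is
  enough, because a complex derivative equals the derivative along the real line, where the function
  is constantly 0.\<close>

lemma higher_deriv_zero_on_positive_reals:
  assumes hol: "U holomorphic_on {s. Re s > 0}"
    and zero: "\<And>\<sigma>::real. \<sigma> > 0 \<Longrightarrow> (deriv ^^ k) U (of_real \<sigma>) = 0"
    and "n \<ge> k" "\<sigma> > 0"
  shows "(deriv ^^ n) U (of_real \<sigma>) = 0"
  using assms(3,4)
proof (induction n arbitrary: \<sigma> rule: dec_induct)
  case base
  then show ?case by (rule zero)
next
  case (step n)
  have op: "open {s::complex. Re s > 0}" by (rule open_halfspace_Re_gt)
  have "((deriv ^^ n) U has_field_derivative deriv ((deriv ^^ n) U) (of_real \<sigma>)) (at (of_real \<sigma>))"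
    using holomorphic_derivI[OF holomorphic_higher_deriv[OF hol op] op] step.prems by simp
  then have "((\<lambda>t. (deriv ^^ n) U (of_real t)) has_vector_derivative deriv ((deriv ^^ n) U) (of_real \<sigma>)) (at \<sigma>)"
    by (rule has_vector_derivative_real_field)
  moreover have "((\<lambda>t. (deriv ^^ n) U (of_real t)) has_vector_derivative 0) (at \<sigma>)"
  proof (rule has_vector_derivative_transform_within_open[of "\<lambda>_. 0" _ _ "{0<..}"])
    show "0 = (deriv ^^ n) U (complex_of_real t)" if "t \<in> {0<..}" for t
      using step.IH[of t] that by simp
  qed (use step.prems in auto)
  ultimately show ?case
    using vector_derivative_unique_at by fastforce
qed

text \<open>The Taylor expansion is centred at time 1, but the value at time 0 must be read off as a
  coefficient. Summing to j = k rather than k - 1 avoids a separate case k = 0.\<close>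

lemma shifted_polynomial_expansion:
  fixes c :: "nat \<Rightarrow> complex"
  obtains q where "\<And>x. (\<Sum>n<k. c n * (x - a) ^ n) = (\<Sum>j\<le>k. q j * x ^ j)"
proof -
  define p where "p = (\<Sum>n<k. smult (c n) ([:- a, 1:] ^ n))"
  have "degree p \<le> k"
    unfolding p_def
  proof (rule degree_sum_le)
    fix n assume "n \<in> {..<k}"
    have "degree (smult (c n) ([:- a, 1:] ^ n)) \<le> degree ([:- a, 1:] ^ n)" by (rule degree_smult_le)
    also have "\<dots> = n" by (simp add: degree_power_eq)
    finally show "degree (smult (c n) ([:- a, 1:] ^ n)) \<le> k" using \<open>n \<in> {..<k}\<close> by simp
  qed simp
  then have "poly p x = (\<Sum>j\<le>k. coeff p j * x ^ j)" for x
    unfolding poly_altdef by (intro sum.mono_neutral_left) (auto simp: coeff_eq_0)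
  moreover have "poly p x = (\<Sum>n<k. c n * (x - a) ^ n)" for x
    by (simp add: p_def poly_sum)
  ultimately show ?thesis using that[of "coeff p"] by simp
qed

context affine_function_space
begin

text \<open>The k of the contradiction hypothesis bounds the degree in time for all \<open>b\<close>
  at once. This uniformity is what lets a single extrapolation formula recover \<open>f\<close> from
  its smoothed versions.\<close>

lemma even_power_mem:
  assumes fV: "f \<in> V" and f: "exp_growth f" and nd: "\<not> f differentiable (at 0)"
  shows "(\<lambda>z. of_real (cmod z ^ (2 * k))) \<in> V"
proof (rule ccontr)
  assume notin: "(\<lambda>z. of_real (cmod z ^ (2 * k))) \<notin> V"
  have "\<exists>q. \<forall>s::real. 0 < s \<longrightarrow> s < 2 \<longrightarrow> heat f s b = (\<Sum>j\<le>k. q j * of_real s ^ j)" for b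
  proof -
    obtain U where U: "U holomorphic_on {s. Re s > 0}" "\<And>s. s > 0 \<Longrightarrow> U (of_real s) = heat f s b"
      using heat_holomorphic_extension[OF f] by blast
    have zero: "(deriv ^^ k) U (of_real \<sigma>) = 0" if \<sigma>: "\<sigma> > 0" for \<sigma> :: real
    proof (rule ccontr)
      define g where "g = U \<circ> (\<lambda>h. of_real \<sigma> + h)"
      assume "(deriv ^^ k) U (of_real \<sigma>) \<noteq> 0"
      then have nz: "(deriv ^^ k) g 0 \<noteq> 0"
        unfolding g_def using higher_deriv_shift_0[of k U "of_real \<sigma>"] by simp
      have "g holomorphic_on ball 0 \<sigma>"
        unfolding g_def
      proof (rule holomorphic_on_compose_gen[OF _ U(1)])
        show "(\<lambda>h. of_real \<sigma> + h) ` ball (0::complex) \<sigma> \<subseteq> {s. Re s > 0}"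
        proof
          fix w :: complex assume "w \<in> (\<lambda>h. of_real \<sigma> + h) ` ball (0::complex) \<sigma>"
          then obtain h where h: "w = of_real \<sigma> + h" "norm h < \<sigma>" unfolding image_iff by force
          then show "w \<in> {s. Re s > 0}" using abs_Re_le_cmod[of h] by simp
        qed
      qed (intro holomorphic_intros)
      moreover have "(\<lambda>z. g (of_real ((cmod z)\<^sup>2))) = (\<lambda>z. heat f (\<sigma> + (cmod z)\<^sup>2) b)"
      proof
        fix z
        have "\<sigma> + (cmod z)\<^sup>2 > 0" using \<sigma> by (simp add: add_pos_nonneg)
        then show "g (of_real ((cmod z)\<^sup>2)) = heat f (\<sigma> + (cmod z)\<^sup>2) b"
          using U(2)[of "\<sigma> + (cmod z)\<^sup>2"] by (simp add: g_def)
      qed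
      ultimately have "(\<lambda>z. (deriv ^^ k) g 0 / fact k * of_real (cmod z ^ (2 * k))) \<in> V"
        using radial_taylor_coefficient_mem[of g \<sigma> k] radial_heat_mem[OF fV f \<sigma>] \<sigma> by simp
      then have "(\<lambda>z. (fact k / (deriv ^^ k) g 0) * ((deriv ^^ k) g 0 / fact k * of_real (cmod z ^ (2 * k)))) \<in> V"
        by (rule scale)
      then show False using notin nz by simp
    qed
    obtain q where q: "\<And>x. (\<Sum>n<k. (deriv ^^ n) U 1 / fact n * (x - 1) ^ n) = (\<Sum>j\<le>k. q j * x ^ j)"
      using shifted_polynomial_expansion[where k = k and c = "\<lambda>n. (deriv ^^ n) U 1 / fact n" and a = 1] by blast
    \<comment> \<open>The largest disc about 1 inside the half-plane; hence times below 2, which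
      include the small ones needed later.\<close>
    have hol1: "U holomorphic_on ball 1 1"
    proof (rule holomorphic_on_subset[OF U(1)], clarsimp simp: dist_norm)
      fix s :: complex assume "norm (1 - s) < 1"
      then show "0 < Re s" using abs_Re_le_cmod[of "1 - s"] by simp
    qed
    have "heat f s b = (\<Sum>j\<le>k. q j * of_real s ^ j)" if s: "0 < s" "s < 2" for s
    proof -
      have "of_real s \<in> ball (1::complex) 1"
      proof -
        have "norm (1 - complex_of_real s) = \<bar>1 - s\<bar>"
          by (metis norm_of_real of_real_1 of_real_diff)
        then show ?thesis using s by (simp add: dist_norm)
      qed
      then have "(\<lambda>n. (deriv ^^ n) U 1 / fact n * (of_real s - 1) ^ n) sums U (of_real s)"
        by (rule holomorphic_power_series[OF hol1])
      moreover have "(\<lambda>n. (deriv ^^ n) U 1 / fact n * (of_real s - 1) ^ n) sums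
         (\<Sum>n<k. (deriv ^^ n) U 1 / fact n * (of_real s - 1) ^ n)"
      proof (rule sums_finite)
        fix n assume "n \<notin> {..<k}"
        then have "(deriv ^^ n) U (of_real 1) = 0"
          by (intro higher_deriv_zero_on_positive_reals[OF U(1) zero]) auto
        then show "(deriv ^^ n) U 1 / fact n * (of_real s - 1) ^ n = 0" by simp
      qed simp
      ultimately have "U (of_real s) = (\<Sum>n<k. (deriv ^^ n) U 1 / fact n * (of_real s - 1) ^ n)"
        by (rule sums_unique2)
      then show ?thesis using U(2)[OF s(1)] q by simp
    qed
    then show ?thesis by blast
  qed
  \<comment> \<open>The coefficients are selected pointwise, so nothing is known yet about their
    dependence on \<open>b\<close>; for the constant one it is regained from the differentiability
    of \<open>heat f s\<close>.\<close>
  then obtain q where q: "\<And>b s::real. 0 < s \<Longrightarrow> s < 2 \<Longrightarrow> heat f s b = (\<Sum>j\<le>k. q b j * of_real s ^ j)"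
    by metis
  have "(\<lambda>b. q b 0) differentiable (at 0)"
  proof (rule polynomial_family_differentiable_zero[where S = 2 and k = k and q = "\<lambda>j b. q b j"])
    fix s :: real assume s: "0 < s" "s < 2"
    have "heat f s = (\<lambda>b. \<Sum>j\<le>k. q b j * of_real s ^ j)" using q[OF s] by auto
    then show "(\<lambda>b. \<Sum>j\<le>k. q b j * of_real s ^ j) differentiable (at 0)"
      using heat_differentiable_zero[OF f s(1)] by simp
  qed simp
  moreover have "q b 0 = f b" for b
  proof -
    have "(\<lambda>n. \<Sum>j\<le>k. q b j * of_real ((1 / real (Suc n))\<^sup>2) ^ j) \<longlonglongrightarrow> (\<Sum>j\<le>k. q b j * of_real (0\<^sup>2) ^ j)"
      by (intro tendsto_intros LIMSEQ_Suc[OF lim_1_over_n])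
    also have "(\<Sum>j\<le>k. q b j * complex_of_real (0\<^sup>2) ^ j) = q b 0"
      by (simp add: power_0_left sum.atMost_shift)
    also have "(\<lambda>n. \<Sum>j\<le>k. q b j * of_real ((1 / real (Suc n))\<^sup>2) ^ j) = (\<lambda>n. heat f ((1 / real (Suc n))\<^sup>2) b)"
    proof
      fix n
      have "(1 / real (Suc n))\<^sup>2 \<le> 1" by (intro power_le_one) auto
      then show "(\<Sum>j\<le>k. q b j * of_real ((1 / real (Suc n))\<^sup>2) ^ j) = heat f ((1 / real (Suc n))\<^sup>2) b"
        by (subst q) auto
    qed
    finally show ?thesis using heat_tendsto[OF f] LIMSEQ_unique by blast
  qed
  ultimately show False using nd by simp
qed

lemma exp_Re_mem:
  assumes "f \<in> V" "exp_growth f" "\<not> f differentiable (at 0)"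
  shows "(\<lambda>z. of_real (exp (Re z))) \<in> V"
proof -
  have radial: "(\<lambda>z. of_real (exp ((cmod z)\<^sup>2 / (2 * R)))) \<in> V" if R: "R > 0" for R :: real
  proof (rule closed)
    fix K :: "complex set" and e :: real assume "compact K" and e: "e > 0"
    then obtain B where B: "B > 0" "\<And>z. z \<in> K \<Longrightarrow> norm z \<le> B"
      using compact_imp_bounded bounded_pos by metis
    define W where "W = B\<^sup>2 / (2 * R)"
    have W: "W > 0" using B R by (simp add: W_def)
    \<comment> \<open>The remainder bound \<open>exp W * W ^ Suc n / fact n\<close>, regrouped so
      that a term of the exponential series appears.\<close>
    have "(\<lambda>n. (exp W * W) * (W ^ n / fact n)) \<longlonglongrightarrow> (exp W * W) * 0"
      by (intro tendsto_mult tendsto_const summable_LIMSEQ_zero)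
        (use summable_exp[of W] in \<open>simp add: divide_inverse mult.commute\<close>)
    then have "\<forall>\<^sub>F n in sequentially. (exp W * W) * (W ^ n / fact n) < e"
      using e by (intro order_tendstoD) auto
    then obtain n where n: "(exp W * W) * (W ^ n / fact n) < e"
      using eventually_happens'[OF sequentially_bot] by blast
    define g :: "complex \<Rightarrow> complex" where "g z = (\<Sum>k\<le>n. of_real (1 / ((2 * R) ^ k * fact k)) * of_real (cmod z ^ (2 * k)))" for z
    have "g \<in> V" unfolding g_def by (intro sum scale even_power_mem[OF assms])
    moreover have "norm (g z - of_real (exp ((cmod z)\<^sup>2 / (2 * R)))) < e" if z: "z \<in> K" for z
    proof -
      define x where "x = (cmod z)\<^sup>2 / (2 * R)"
      have x: "0 \<le> x" "x \<le> W" using B(2)[OF z] R by (auto simp: x_def W_def intro!: divide_right_mono power_mono)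
      have "g z = (\<Sum>k\<le>n. of_real x ^ k / fact k)"
        by (simp add: g_def x_def power_divide power_mult_distrib mult.commute flip: power_mult)
      then have "norm (g z - of_real (exp x)) = norm (exp (complex_of_real x) - (\<Sum>k\<le>n. of_real x ^ k / fact k))"
        by (simp add: exp_of_real norm_minus_commute)
      also have "\<dots> \<le> exp \<bar>Re (of_real x)\<bar> * norm (complex_of_real x) ^ Suc n / fact n"
        by (rule Taylor_exp)
      also have "\<dots> \<le> exp W * W ^ Suc n / fact n"
        using x by (intro divide_right_mono mult_mono power_mono) auto
      also have "\<dots> < e" using n by simp
      finally show ?thesis unfolding x_def .
    qed
    ultimately show "\<exists>g\<in>V. \<forall>z\<in>K. norm (g z - of_real (exp ((cmod z)\<^sup>2 / (2 * R)))) < e" by blast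
  qed
  show ?thesis
  proof (rule closed)
    fix K :: "complex set" and e :: real assume "compact K" and e: "e > 0"
    then obtain B where B: "B > 0" "\<And>z. z \<in> K \<Longrightarrow> norm z \<le> B"
      using compact_imp_bounded bounded_pos by metis
    have "(\<lambda>n. exp B * (exp (B\<^sup>2 / 2 * (1 / real n)) - 1)) \<longlonglongrightarrow> exp B * (exp (B\<^sup>2 / 2 * 0) - 1)"
      by (intro tendsto_intros lim_1_over_n)
    then have "\<forall>\<^sub>F n in sequentially. exp B * (exp (B\<^sup>2 / 2 * (1 / real n)) - 1) < e"
      using e by (intro order_tendstoD) auto
    then have "\<forall>\<^sub>F n in sequentially. exp B * (exp (B\<^sup>2 / 2 * (1 / real n)) - 1) < e \<and> n > 0"
      using eventually_gt_at_top[of 0] by (rule eventually_conj)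
    then obtain n where n: "exp B * (exp (B\<^sup>2 / 2 * (1 / real n)) - 1) < e" "n > 0"
      using eventually_happens'[OF sequentially_bot] by blast
    define R where "R = real n"
    have R: "R > 0" using n by (simp add: R_def)
    \<comment> \<open>The prefactor cancels the constant in
      \<open>|z + R|^2 / (2 * R) = R / 2 + Re z + |z|^2 / (2 * R)\<close>.\<close>
    define g where "g z = of_real (exp (- R / 2)) * complex_of_real (exp ((cmod (1 * z + of_real R))\<^sup>2 / (2 * R)))" for z
    have "g \<in> V" unfolding g_def by (rule scale[OF affine[OF radial[OF R]]])
    moreover have "norm (g z - of_real (exp (Re z))) < e" if z: "z \<in> K" for z
    proof -
      define y where "y = (cmod z)\<^sup>2 / (2 * R)"
      have "(cmod z)\<^sup>2 \<le> B\<^sup>2" using B(2)[OF z] by (intro power_mono) auto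
      then have y: "0 \<le> y" "y \<le> B\<^sup>2 / 2 * (1 / real n)" using R by (auto simp: y_def R_def divide_right_mono)
      have "- R / 2 + (cmod (1 * z + of_real R))\<^sup>2 / (2 * R) = Re z + y"
      proof -
        have "(cmod (1 * z + of_real R))\<^sup>2 = (cmod z)\<^sup>2 + 2 * R * Re z + R\<^sup>2"
          unfolding cmod_power2 by (simp add: power2_eq_square algebra_simps)
        then show ?thesis
          using R by (simp only: y_def add_divide_distrib) (simp add: power2_eq_square)
      qed
      then have "g z = of_real (exp (Re z) * exp y)"
        unfolding g_def of_real_mult[symmetric] exp_add[symmetric] by simp
      then have "g z - of_real (exp (Re z)) = of_real (exp (Re z) * (exp y - 1))"
        by (simp add: algebra_simps)
      then have "norm (g z - of_real (exp (Re z))) = exp (Re z) * (exp y - 1)"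
        using y by (simp only: norm_of_real) (simp add: abs_mult)
      also have "\<dots> \<le> exp B * (exp (B\<^sup>2 / 2 * (1 / real n)) - 1)"
        using y B(2)[OF z] abs_Re_le_cmod[of z] by (intro mult_mono) auto
      also have "\<dots> < e" by (rule n)
      finally show ?thesis .
    qed
    ultimately show "\<exists>g\<in>V. \<forall>z\<in>K. norm (g z - of_real (exp (Re z))) < e" by blast
  qed
qed

end

section \<open>Density of shallow networks\<close>

text \<open>Bilinear, without conjugation, as a row of a complex matrix acts on a vector.\<close>

definition dotp :: "complex ^ 'n \<Rightarrow> complex ^ 'n \<Rightarrow> complex" where
  "dotp a x = (\<Sum>i\<in>UNIV. a $ i * x $ i)"

lemma continuous_on_dotp [continuous_intros]: "continuous_on S (dotp a)"
  unfolding dotp_def by (intro continuous_intros)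

lemma dotp_scale: "dotp (c *s a) x = c * dotp a x"
  by (simp add: dotp_def sum_distrib_left mult.assoc)

lemma dotp_add: "dotp (a + b) x = dotp a x + dotp b x"
  by (simp add: dotp_def distrib_right sum.distrib)

lemma dotp_zero [simp]: "dotp 0 x = 0"
  by (simp add: dotp_def)

lemma dotp_axis [simp]: "dotp (axis i c) x = c * x $ i"
  by (simp add: dotp_def axis_def if_distrib[of "\<lambda>t. t * _"] cong: if_cong)

definition shallow :: "(complex \<Rightarrow> complex) \<Rightarrow> (complex \<times> (complex ^ 'n) \<times> complex) list \<Rightarrow> complex ^ 'n \<Rightarrow> complex" where
  "shallow \<rho> js x = (\<Sum>(c, a, b)\<leftarrow>js. c * \<rho> (dotp a x + b))"

definition shallow_closure :: "(complex \<Rightarrow> complex) \<Rightarrow> (complex ^ 'n \<Rightarrow> complex) set" where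
  "shallow_closure \<rho> = {f. \<forall>K \<epsilon>. compact K \<longrightarrow> \<epsilon> > 0 \<longrightarrow> (\<exists>js. \<forall>x\<in>K. norm (shallow \<rho> js x - f x) < \<epsilon>)}"

lemma shallow_closureD:
  "f \<in> shallow_closure \<rho> \<Longrightarrow> compact K \<Longrightarrow> \<epsilon> > 0 \<Longrightarrow> \<exists>js. \<forall>x\<in>K. norm (shallow \<rho> js x - f x) < \<epsilon>"
  unfolding shallow_closure_def by blast

lemma shallow_append: "shallow \<rho> (js @ js') x = shallow \<rho> js x + shallow \<rho> js' x"
  by (simp add: shallow_def)

lemma shallow_scale: "shallow \<rho> (map (\<lambda>(c, a, b). (k * c, a, b)) js) x = k * shallow \<rho> js x"
  unfolding shallow_def by (induction js) (auto simp: algebra_simps)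

lemma closed_function_space_shallow:
  "closed_function_space (shallow_closure \<rho> :: (complex ^ 'n \<Rightarrow> complex) set)"
proof
  show "(\<lambda>_. 0) \<in> shallow_closure \<rho>"
    unfolding shallow_closure_def by (auto intro!: exI[of _ "[]"] simp: shallow_def)
next
  fix f g :: "complex ^ 'n \<Rightarrow> complex"
  assume f: "f \<in> shallow_closure \<rho>" and g: "g \<in> shallow_closure \<rho>"
  show "(\<lambda>z. f z + g z) \<in> shallow_closure \<rho>"
    unfolding shallow_closure_def
  proof (clarify)
    fix K :: "(complex ^ 'n) set" and e :: real assume K: "compact K" "e > 0"
    obtain js where js: "\<And>x. x \<in> K \<Longrightarrow> norm (shallow \<rho> js x - f x) < e / 2"
      using shallow_closureD[OF f K(1), of "e / 2"] K(2) by auto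
    obtain js' where js': "\<And>x. x \<in> K \<Longrightarrow> norm (shallow \<rho> js' x - g x) < e / 2"
      using shallow_closureD[OF g K(1), of "e / 2"] K(2) by auto
    have "norm (shallow \<rho> (js @ js') x - (f x + g x)) < e" if "x \<in> K" for x
      using norm_triangle_ineq[of "shallow \<rho> js x - f x" "shallow \<rho> js' x - g x"] js[OF that] js'[OF that]
      by (simp add: shallow_append add_diff_add)
    then show "\<exists>js. \<forall>x\<in>K. norm (shallow \<rho> js x - (f x + g x)) < e" by blast
  qed
next
  fix f :: "complex ^ 'n \<Rightarrow> complex" and c
  assume f: "f \<in> shallow_closure \<rho>"
  show "(\<lambda>z. c * f z) \<in> shallow_closure \<rho>"
    unfolding shallow_closure_def
  proof (clarify)
    fix K :: "(complex ^ 'n) set" and e :: real assume K: "compact K" "e > 0"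
    then have e': "e / (norm c + 1) > 0" by (simp add: add_nonneg_pos)
    then obtain js where js: "\<And>x. x \<in> K \<Longrightarrow> norm (shallow \<rho> js x - f x) < e / (norm c + 1)"
      using shallow_closureD[OF f K(1)] by blast
    have "norm (shallow \<rho> (map (\<lambda>(k, a, b). (c * k, a, b)) js) x - c * f x) < e" if "x \<in> K" for x
    proof -
      have "norm (shallow \<rho> (map (\<lambda>(k, a, b). (c * k, a, b)) js) x - c * f x) = norm c * norm (shallow \<rho> js x - f x)"
        unfolding shallow_scale right_diff_distrib[symmetric] norm_mult ..
      also have "\<dots> \<le> (norm c) * (e / (norm c + 1))"
        using js[OF that] by (intro mult_left_mono) auto
      also have "\<dots> < (norm c + 1) * (e / (norm c + 1))"
        using e' by (intro mult_strict_right_mono) auto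
      also have "\<dots> = e" using e' K(2) by (auto simp: zero_less_divide_iff)
      finally show ?thesis .
    qed
    then show "\<exists>js. \<forall>x\<in>K. norm (shallow \<rho> js x - c * f x) < e" by blast
  qed
next
  fix f :: "complex ^ 'n \<Rightarrow> complex"
  assume f: "\<And>K \<epsilon>. compact K \<Longrightarrow> \<epsilon> > 0 \<Longrightarrow> \<exists>g\<in>shallow_closure \<rho>. \<forall>z\<in>K. norm (g z - f z) < \<epsilon>"
  show "f \<in> shallow_closure \<rho>"
    unfolding shallow_closure_def
  proof (clarify)
    fix K :: "(complex ^ 'n) set" and e :: real assume K: "compact K" "e > 0"
    obtain g where g: "g \<in> shallow_closure \<rho>" "\<And>z. z \<in> K \<Longrightarrow> norm (g z - f z) < e / 2"
      using f[OF K(1), of "e / 2"] K(2) by auto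
    obtain js where js: "\<And>x. x \<in> K \<Longrightarrow> norm (shallow \<rho> js x - g x) < e / 2"
      using shallow_closureD[OF g(1) K(1), of "e / 2"] K(2) by auto
    have "norm (shallow \<rho> js x - f x) < e" if "x \<in> K" for x
      using norm_triangle_ineq[of "shallow \<rho> js x - g x" "g x - f x"] js[OF that] g(2)[OF that] by simp
    then show "\<exists>js. \<forall>x\<in>K. norm (shallow \<rho> js x - f x) < e" by blast
  qed
qed

lemma ridge_mem_shallow_closure: "(\<lambda>x. \<rho> (dotp a x + b)) \<in> shallow_closure \<rho>"
  unfolding shallow_closure_def by (auto intro!: exI[of _ "[(1, a, b)]"] simp: shallow_def)

text \<open>This carries the one-variable theory to n variables: the univariate functions all of
  whose ridge functions are approximable form an admissible \<open>V\<close>. It is closed because a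
  ridge direction maps compact sets to compact sets.\<close>

lemma affine_function_space_ridge:
  "affine_function_space {f. \<forall>(a::complex ^ 'n) b. (\<lambda>x. f (dotp a x + b)) \<in> shallow_closure \<rho>}"
proof -
  interpret S: closed_function_space "shallow_closure \<rho> :: (complex ^ 'n \<Rightarrow> complex) set"
    by (rule closed_function_space_shallow)
  show ?thesis
  proof
    fix f :: "complex \<Rightarrow> complex"
    let ?V = "{f. \<forall>(a::complex ^ 'n) b. (\<lambda>x. f (dotp a x + b)) \<in> shallow_closure \<rho>}"
    assume f: "\<And>K \<epsilon>. compact K \<Longrightarrow> \<epsilon> > 0 \<Longrightarrow> \<exists>g\<in>?V. \<forall>z\<in>K. norm (g z - f z) < \<epsilon>"
    show "f \<in> ?V"
    proof (clarify, rule S.closed)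
      fix a :: "complex ^ 'n" and b and K :: "(complex ^ 'n) set" and e :: real assume K: "compact K" "e > 0"
      have "compact ((\<lambda>x. dotp a x + b) ` K)"
        by (intro compact_continuous_image continuous_intros K)
      from f[OF this K(2)] show "\<exists>g\<in>shallow_closure \<rho>. \<forall>z\<in>K. norm (g z - f (dotp a z + b)) < e"
        by force
    qed
  next
    fix f :: "complex \<Rightarrow> complex" and a b
    assume f: "f \<in> {f. \<forall>(a::complex ^ 'n) b. (\<lambda>x. f (dotp a x + b)) \<in> shallow_closure \<rho>}"
    have "(\<lambda>x. f (a * (dotp a' x + b') + b)) \<in> shallow_closure \<rho>" for a' :: "complex ^ 'n" and b'
    proof -
      have "(\<lambda>x. f (dotp (a *s a') x + (a * b' + b))) \<in> shallow_closure \<rho>" using f by blast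
      then show ?thesis by (simp add: dotp_scale algebra_simps)
    qed
    then show "(\<lambda>z. f (a * z + b)) \<in> {f. \<forall>(a::complex ^ 'n) b. (\<lambda>x. f (dotp a x + b)) \<in> shallow_closure \<rho>}"
      by blast
  qed (auto intro: S.zero S.add S.scale)
qed

text \<open>Every real-linear functional on the complex n-space has the form
  \<open>Re (dotp a x)\<close>, so these are the real exponential sums in 2n real variables.
  Products need no clause, since exponents add.\<close>

inductive_set exp_sums :: "(complex ^ 'n \<Rightarrow> real) set" where
  base: "(\<lambda>x. c * exp (Re (dotp a x))) \<in> exp_sums"
| add: "f \<in> exp_sums \<Longrightarrow> g \<in> exp_sums \<Longrightarrow> (\<lambda>x. f x + g x) \<in> exp_sums"

lemma exp_sums_mult:
  assumes "f \<in> exp_sums" "g \<in> exp_sums"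
  shows "(\<lambda>x. f x * g x) \<in> exp_sums"
  using assms
proof (induction f rule: exp_sums.induct)
  case (base c a)
  from base show ?case
  proof (induction g rule: exp_sums.induct)
    case (base d b)
    have "(\<lambda>x. (c * d) * exp (Re (dotp (a + b) x))) \<in> exp_sums" by (rule exp_sums.base)
    then show ?case by (simp add: dotp_add exp_add mult_ac)
  next
    case (add f g)
    then show ?case using exp_sums.add[OF add.IH] by (simp add: algebra_simps)
  qed
next
  case (add f1 f2)
  then show ?case using exp_sums.add[of "\<lambda>x. f1 x * g x" "\<lambda>x. f2 x * g x"] by (simp add: algebra_simps)
qed

lemma exp_sums_dense:
  fixes f :: "complex ^ 'n \<Rightarrow> real"
  assumes K: "compact K" and f: "continuous_on K f" and e: "e > 0"
  shows "\<exists>g\<in>exp_sums. \<forall>x\<in>K. \<bar>f x - g x\<bar> < e"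
proof -
  have "continuous_on S g" if "g \<in> exp_sums" for S and g :: "complex ^ 'n \<Rightarrow> real"
    using that by induction (auto intro!: continuous_intros)
  moreover have "(\<lambda>_::complex ^ 'n. c) \<in> exp_sums" for c
    using exp_sums.base[of c 0] by simp
  moreover have "\<exists>g\<in>exp_sums. g x \<noteq> g y" if xy: "x \<noteq> y" for x y :: "complex ^ 'n"
  proof -
    obtain i where i: "x $ i \<noteq> y $ i" using xy by (auto simp: vec_eq_iff)
    then consider "Re (x $ i) \<noteq> Re (y $ i)" | "Im (x $ i) \<noteq> Im (y $ i)" by (auto simp: complex_eq_iff)
    then show ?thesis
    proof cases
      case 1
      then show ?thesis using exp_sums.base[of 1 "axis i 1"] by (intro bexI) auto
    next
      case 2
      \<comment> \<open>\<open>Re (- \<i> * x $ i) = Im (x $ i)\<close>.\<close>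
      then show ?thesis using exp_sums.base[of 1 "axis i (- \<i>)"] by (intro bexI) auto
    qed
  qed
  ultimately interpret function_ring_on exp_sums K
    using K by unfold_locales (auto intro: exp_sums.add exp_sums_mult)
  show ?thesis by (rule Stone_Weierstrass_basic[OF f e])
qed


lemma shallow_closure_eq_continuous:
  fixes g :: "complex ^ 'n \<Rightarrow> complex"
  assumes f: "exp_growth \<rho>" "\<not> \<rho> differentiable (at 0)" and g: "continuous_on UNIV g"
  shows "g \<in> shallow_closure (\<rho> :: complex \<Rightarrow> complex)"
proof -
  interpret S: closed_function_space "shallow_closure \<rho> :: (complex ^ 'n \<Rightarrow> complex) set"
    by (rule closed_function_space_shallow)
  \<comment> \<open>The ridge space serves as \<open>V\<close>; it contains the activation by
    \<open>ridge_mem_shallow_closure\<close>.\<close>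
  have "(\<lambda>z. of_real (exp (Re z))) \<in> {f. \<forall>(a::complex ^ 'n) b. (\<lambda>x. f (dotp a x + b)) \<in> shallow_closure \<rho>}"
    by (rule affine_function_space.exp_Re_mem[OF affine_function_space_ridge _ f])
      (auto intro: ridge_mem_shallow_closure)
  then have ridge: "(\<lambda>x. of_real (exp (Re (dotp a x + 0)))) \<in> shallow_closure \<rho>" for a :: "complex ^ 'n"
    by blast
  have sums: "(\<lambda>x. complex_of_real (h x)) \<in> shallow_closure \<rho>" if "h \<in> exp_sums" for h :: "complex ^ 'n \<Rightarrow> real"
    using that
  proof induction
    case (base c a)
    then show ?case using S.scale[OF ridge, of "of_real c" a] by simp
  next
    case (add f g)
    then show ?case using S.add[OF add.IH] by simp
  qed
  show ?thesis
  proof (rule S.closed)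
    fix K :: "(complex ^ 'n) set" and e :: real assume K: "compact K" "e > 0"
    have cont: "continuous_on K (\<lambda>x. Re (g x))" "continuous_on K (\<lambda>x. Im (g x))"
      by (intro continuous_intros continuous_on_subset[OF g] subset_UNIV)+
    obtain h1 where h1: "h1 \<in> exp_sums" "\<And>x. x \<in> K \<Longrightarrow> \<bar>Re (g x) - h1 x\<bar> < e / 2"
      using exp_sums_dense[OF K(1) cont(1), of "e / 2"] K(2) by auto
    obtain h2 where h2: "h2 \<in> exp_sums" "\<And>x. x \<in> K \<Longrightarrow> \<bar>Im (g x) - h2 x\<bar> < e / 2"
      using exp_sums_dense[OF K(1) cont(2), of "e / 2"] K(2) by auto
    have mem: "(\<lambda>x. of_real (h1 x) + \<i> * of_real (h2 x)) \<in> shallow_closure \<rho>"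
      by (intro S.add S.scale sums h1 h2)
    have "norm (of_real (h1 x) + \<i> * of_real (h2 x) - g x) < e" if "x \<in> K" for x
      using cmod_le[of "of_real (h1 x) + \<i> * of_real (h2 x) - g x"] h1(2)[OF that] h2(2)[OF that]
      by (simp add: abs_minus_commute)
    then show "\<exists>f\<in>shallow_closure \<rho>. \<forall>x\<in>K. norm (f x - g x) < e"
      by (intro bexI[OF _ mem] ballI)
  qed
qed

text \<open>Each term is one scalar neuron times a coefficient vector in the output space, the shape
  in which a narrow network with a single computing cell can accumulate it.\<close>

definition vshallow :: "(complex \<Rightarrow> complex) \<Rightarrow> ((complex ^ 'm) \<times> (complex ^ 'n) \<times> complex) list \<Rightarrow> complex ^ 'n \<Rightarrow> complex ^ 'm" where
  "vshallow \<rho> js x = (\<Sum>(\<alpha>, a, b)\<leftarrow>js. \<rho> (dotp a x + b) *s \<alpha>)"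

lemma vshallow_axis:
  "vshallow \<rho> (map (\<lambda>(c, a, b). (axis k c, a, b)) js) x = axis k (shallow \<rho> js x)"
  unfolding vshallow_def shallow_def
  by (induction js) (auto simp: vec_eq_iff axis_def)

lemma norm_vec_le_sum: "norm (v :: complex ^ 'm) \<le> (\<Sum>i\<in>UNIV. norm (v $ i))"
  by (simp add: norm_vec_def L2_set_le_sum)

lemma norm_vec_less:
  fixes v :: "complex ^ 'm"
  assumes "\<And>i. norm (v $ i) < e / CARD('m)"
  shows "norm v < e"
proof -
  have "norm v \<le> (\<Sum>i\<in>UNIV. norm (v $ i))" by (rule norm_vec_le_sum)
  also have "\<dots> < (\<Sum>i\<in>(UNIV::'m set). e / CARD('m))" using assms by (intro sum_strict_mono) auto
  also have "\<dots> = e" by simp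
  finally show ?thesis .
qed

lemma vshallow_dense:
  fixes g :: "complex ^ 'n \<Rightarrow> complex ^ 'm"
  assumes \<rho>: "exp_growth \<rho>" "\<not> \<rho> differentiable (at 0)" and g: "continuous_on UNIV g"
    and K: "compact K" and e: "e > 0"
  shows "\<exists>js. \<forall>x\<in>K. norm (vshallow \<rho> js x - g x) < e"
proof -
  have "\<exists>js. \<forall>x\<in>K. norm (shallow \<rho> js x - g x $ j) < e / CARD('m)" for j
  proof -
    have "continuous_on UNIV (\<lambda>x. g x $ j)" by (intro continuous_intros g)
    from shallow_closure_eq_continuous[OF \<rho> this] show ?thesis
      using K e unfolding shallow_closure_def by auto
  qed
  then have "\<forall>j. \<exists>js. \<forall>x\<in>K. norm (shallow \<rho> js x - g x $ j) < e / CARD('m)" by blast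
  from choice[OF this] obtain s where s: "\<And>j x. x \<in> K \<Longrightarrow> norm (shallow \<rho> (s j) x - g x $ j) < e / CARD('m)"
    by blast
  \<comment> \<open>Outputs are added one at a time: the network for component k enters with
    coefficient vectors on \<open>axis k\<close> and leaves the other components alone.\<close>
  have sel: "\<exists>js. \<forall>x j. vshallow \<rho> js x $ j = (if j \<in> J then shallow \<rho> (s j) x else 0)" for J :: "'m set"
  proof (induction J rule: finite_induct[OF finite])
    case 1
    show ?case by (intro exI[of _ "[]"]) (simp add: vshallow_def)
  next
    case (2 k J)
    then obtain js where js: "\<And>x j. vshallow \<rho> js x $ j = (if j \<in> J then shallow \<rho> (s j) x else 0)" by blast
    let ?js = "map (\<lambda>(c, a, b). (axis k c, a, b)) (s k) @ js"
    have "vshallow \<rho> ?js x = axis k (shallow \<rho> (s k) x) + vshallow \<rho> js x" for x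
      unfolding vshallow_axis[symmetric] by (simp add: vshallow_def)
    then show ?case using js 2 by (intro exI[of _ ?js]) (auto simp: axis_def)
  qed
  obtain js where js: "\<And>x j. vshallow \<rho> js x $ j = shallow \<rho> (s j) x"
    using sel[of UNIV] by auto
  have "norm (vshallow \<rho> js x - g x) < e" if "x \<in> K" for x
    by (rule norm_vec_less) (use s[OF that] js in simp)
  then show ?thesis by blast
qed

section \<open>Narrow networks\<close>

lemma bounded_linear_matrix_vector: "bounded_linear (\<lambda>v. (M :: complex ^ 'n ^ 'm) *v v)"
proof (rule linear_conv_bounded_linear[THEN iffD1], rule linearI)
  show "M *v (x + y) = M *v x + M *v y" for x y
    by (rule matrix_vector_right_distrib)
  show "M *v (r *\<^sub>R x) = r *\<^sub>R (M *v x)" for r x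
    by (simp add: matrix_vector_mult_def vec_eq_iff scaleR_sum_right)
qed

lemma compact_image_norm_bound:
  fixes f :: "'a::topological_space \<Rightarrow> 'b::real_normed_vector"
  assumes "compact K" "continuous_on K f"
  obtains B where "B > 0" "\<And>x. x \<in> K \<Longrightarrow> norm (f x) \<le> B"
proof -
  have "bounded (f ` K)" using compact_continuous_image[OF assms(2,1)] by (rule compact_imp_bounded)
  then obtain B where "B > 0" "\<forall>y\<in>f ` K. norm y \<le> B" unfolding bounded_pos by blast
  then show ?thesis using that[of B] by simp
qed

lemma continuous_on_matrix_vector [continuous_intros]:
  "continuous_on S f \<Longrightarrow> continuous_on S (\<lambda>x. (M :: complex ^ 'n ^ 'm) *v f x)"
  by (rule bounded_linear.continuous_on[OF bounded_linear_matrix_vector])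

lemma diagonal_matrix_mult:
  "(\<chi> i j. if i = j then p i else 0) *v (y :: complex ^ 'w) = (\<chi> i. p i * y $ i)"
  by (simp add: matrix_vector_mult_def vec_eq_iff if_distrib[of "\<lambda>t. t * _"] cong: if_cong)

text \<open>A substitute for linearisation at a fixed point: the base point \<beta> may move with B
  and \<epsilon>. There is no output offset, so undoing the rescaling is a purely linear
  operation.\<close>

definition approximates_identity :: "(complex \<Rightarrow> complex) \<Rightarrow> bool" where
  "approximates_identity \<rho> \<longleftrightarrow>
    (\<forall>B>0. \<forall>\<epsilon>>0. \<exists>\<alpha> \<beta> \<gamma>. \<forall>u. norm u \<le> B \<longrightarrow> norm (\<gamma> * \<rho> (\<alpha> * u + \<beta>) - u) < \<epsilon>)"

text \<open>An idealised layer in which the neurons outside \<open>I\<close> are exact identity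
  connections.\<close>

definition partial_act :: "(complex \<Rightarrow> complex) \<Rightarrow> 'w set \<Rightarrow> complex ^ 'w \<Rightarrow> complex ^ 'w" where
  "partial_act \<rho> I y = (\<chi> i. if i \<in> I then \<rho> (y $ i) else y $ i)"

lemma continuous_on_partial_act:
  assumes "continuous_on UNIV \<rho>"
  shows "continuous_on S (partial_act \<rho> I)"
  unfolding partial_act_def
proof (rule continuous_on_vec_lambda)
  fix i
  show "continuous_on S (\<lambda>y. if i \<in> I then \<rho> (y $ i) else y $ i)"
    by (cases "i \<in> I") (auto intro!: continuous_intros continuous_on_compose2[OF assms])
qed

lemma layer_approximates_partial_act:
  fixes I :: "'w::finite set"
  assumes id: "approximates_identity \<rho>" and B: "B > 0" and e: "e > 0"
  shows "\<exists>(D :: complex ^ 'w ^ 'w) d (E :: complex ^ 'w ^ 'w).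
     \<forall>y. norm y \<le> B \<longrightarrow> norm (E *v act \<rho> (D *v y + d) - partial_act \<rho> I y) < e"
proof -
  have e': "e / CARD('w) > 0" using e by simp
  then obtain \<alpha> \<beta> \<gamma> where id': "\<And>u. norm u \<le> B \<Longrightarrow> norm (\<gamma> * \<rho> (\<alpha> * u + \<beta>) - u) < e / CARD('w)"
    using id B unfolding approximates_identity_def by blast
  \<comment> \<open>Diagonal pre- and postscaling: computing neurons are left alone, transporting
    ones use \<alpha>, \<beta> before and \<gamma> after the activation.\<close>
  define D :: "complex ^ 'w ^ 'w" where "D = (\<chi> i j. if i = j then (if i \<in> I then 1 else \<alpha>) else 0)"
  define d :: "complex ^ 'w" where "d = (\<chi> i. if i \<in> I then 0 else \<beta>)"
  define E :: "complex ^ 'w ^ 'w" where "E = (\<chi> i j. if i = j then (if i \<in> I then 1 else \<gamma>) else 0)"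
  have "norm (E *v act \<rho> (D *v y + d) - partial_act \<rho> I y) < e" if y: "norm y \<le> B" for y
  proof (rule norm_vec_less)
    fix i
    have "norm (y $ i) \<le> B" using y Finite_Cartesian_Product.norm_nth_le order_trans by blast
    then show "norm ((E *v act \<rho> (D *v y + d) - partial_act \<rho> I y) $ i) < e / CARD('w)"
      using id' e' unfolding D_def E_def diagonal_matrix_mult by (auto simp: act_def d_def partial_act_def)
  qed
  then show ?thesis by blast
qed

text \<open>The trailing \<open>M\<close> stands for the rescaling still owed after the last
  activation. It is not a layer of its own: the next affine map, or the output map, absorbs
  it.\<close>

definition net_approximable :: "(complex \<Rightarrow> complex) \<Rightarrow> (complex ^ 'n \<Rightarrow> complex ^ 'w) \<Rightarrow> bool" where
  "net_approximable \<rho> f \<longleftrightarrow> (\<forall>K \<epsilon>. compact K \<longrightarrow> \<epsilon> > 0 \<longrightarrow>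
     (\<exists>(A :: complex ^ 'n ^ 'w) b Hs (M :: complex ^ 'w ^ 'w).
        \<forall>x\<in>K. norm (M *v hidden_layers \<rho> Hs (act \<rho> (A *v x + b)) - f x) < \<epsilon>))"

lemma net_approximableD:
  fixes f :: "complex ^ 'n \<Rightarrow> complex ^ 'w"
  assumes "net_approximable \<rho> f" "compact K" "\<epsilon> > 0"
  shows "\<exists>(A :: complex ^ 'n ^ 'w) b Hs (M :: complex ^ 'w ^ 'w).
        \<forall>x\<in>K. norm (M *v hidden_layers \<rho> Hs (act \<rho> (A *v x + b)) - f x) < \<epsilon>"
  using assms unfolding net_approximable_def by blast

lemma net_approximable_first_layer:
  fixes A :: "complex ^ 'n ^ 'w"
  assumes id: "approximates_identity \<rho>"
  shows "net_approximable \<rho> (\<lambda>x. partial_act \<rho> I (A *v x + b))"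
  unfolding net_approximable_def
proof (intro allI impI)
  fix K :: "(complex ^ 'n) set" and e :: real assume K: "compact K" "e > 0"
  have "continuous_on K (\<lambda>x. A *v x + b)" by (intro continuous_intros)
  then obtain B where B: "B > 0" "\<And>x. x \<in> K \<Longrightarrow> norm (A *v x + b) \<le> B"
    using compact_image_norm_bound[OF K(1)] by blast
  obtain D :: "complex ^ 'w ^ 'w" and d and E :: "complex ^ 'w ^ 'w"
    where DE: "\<And>y. norm y \<le> B \<Longrightarrow> norm (E *v act \<rho> (D *v y + d) - partial_act \<rho> I y) < e"
    using layer_approximates_partial_act[OF id B(1) K(2)] by blast
  have "norm (E *v hidden_layers \<rho> [] (act \<rho> ((D ** A) *v x + (D *v b + d))) - partial_act \<rho> I (A *v x + b)) < e"
    if "x \<in> K" for x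
    using DE[OF B(2)[OF that]]
    by (simp add: hidden_layers_def matrix_vector_right_distrib matrix_vector_mul_assoc add.assoc)
  then show "\<exists>(A' :: complex ^ 'n ^ 'w) b' Hs (M :: complex ^ 'w ^ 'w).
        \<forall>x\<in>K. norm (M *v hidden_layers \<rho> Hs (act \<rho> (A' *v x + b')) - partial_act \<rho> I (A *v x + b)) < e"
    by blast
qed

text \<open>Two errors add up: replacing the ideal layer by a real one, and feeding it an
  approximate state. The second is controlled by uniform continuity of the ideal layer on a
  ball.\<close>

lemma net_approximable_next_layer:
  fixes f :: "complex ^ 'n \<Rightarrow> complex ^ 'w" and T :: "complex ^ 'w ^ 'w"
  assumes id: "approximates_identity \<rho>" and cont: "continuous_on UNIV \<rho>"
    and f: "net_approximable \<rho> f" and cf: "continuous_on UNIV f"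
  shows "net_approximable \<rho> (\<lambda>x. partial_act \<rho> I (T *v f x + t))"
  unfolding net_approximable_def
proof (intro allI impI)
  fix K :: "(complex ^ 'n) set" and e :: real assume K: "compact K" "e > 0"
  obtain B0 where B0: "B0 > 0" "\<And>x. x \<in> K \<Longrightarrow> norm (f x) \<le> B0"
    using compact_image_norm_bound[OF K(1) continuous_on_subset[OF cf subset_UNIV]] by blast
  \<comment> \<open>The extra 1 leaves room for the perturbed state, whose error is kept below
    \<open>min \<delta> 1\<close>.\<close>
  let ?C = "cball (0 :: complex ^ 'w) (B0 + 1)"
  have "continuous_on ?C (\<lambda>y. T *v y + t)" by (intro continuous_intros)
  then obtain B where B: "B > 0" "\<And>y. y \<in> ?C \<Longrightarrow> norm (T *v y + t) \<le> B"
    using compact_image_norm_bound[OF compact_cball] by blast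
  define \<Lambda> where "\<Lambda> y = partial_act \<rho> I (T *v y + t)" for y
  have "uniformly_continuous_on ?C \<Lambda>"
    unfolding \<Lambda>_def
    by (intro compact_uniformly_continuous compact_cball
        continuous_on_compose2[OF continuous_on_partial_act[OF cont, of UNIV]] continuous_intros) auto
  moreover have e2: "e / 2 > 0" using K(2) by simp
  ultimately obtain \<delta> where \<delta>: "\<delta> > 0"
    and uc: "\<And>y y'. y \<in> ?C \<Longrightarrow> y' \<in> ?C \<Longrightarrow> dist y' y < \<delta> \<Longrightarrow> dist (\<Lambda> y') (\<Lambda> y) < e / 2"
    unfolding uniformly_continuous_on_def by meson
  obtain D :: "complex ^ 'w ^ 'w" and d and E :: "complex ^ 'w ^ 'w"
    where DE: "\<And>y. norm y \<le> B \<Longrightarrow> norm (E *v act \<rho> (D *v y + d) - partial_act \<rho> I y) < e / 2"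
    using layer_approximates_partial_act[OF id B(1) e2] by blast
  have "min \<delta> 1 > 0" using \<delta> by simp
  then obtain A :: "complex ^ 'n ^ 'w" and b Hs and M :: "complex ^ 'w ^ 'w"
    where net: "\<And>x. x \<in> K \<Longrightarrow> norm (M *v hidden_layers \<rho> Hs (act \<rho> (A *v x + b)) - f x) < min \<delta> 1"
    using net_approximableD[OF f K(1)] by blast
  \<comment> \<open>\<open>M\<close>, \<open>T\<close> and \<open>D\<close> fuse into one affine
    map, expanding \<open>D (T (M v) + t) + d\<close>.\<close>
  define Hs' where "Hs' = Hs @ [(D ** (T ** M), D *v t + d)]"
  have "norm (E *v hidden_layers \<rho> Hs' (act \<rho> (A *v x + b)) - \<Lambda> (f x)) < e" if x: "x \<in> K" for x
  proof -
    define y where "y = M *v hidden_layers \<rho> Hs (act \<rho> (A *v x + b))"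
    have yf: "norm (y - f x) < min \<delta> 1" using net[OF x] by (simp add: y_def)
    have yC: "y \<in> ?C" "f x \<in> ?C"
      using B0(2)[OF x] yf norm_triangle_ineq[of "y - f x" "f x"] by auto
    have "hidden_layers \<rho> Hs' (act \<rho> (A *v x + b)) = act \<rho> (D *v (T *v y + t) + d)"
      by (simp add: Hs'_def hidden_layers_def y_def matrix_vector_right_distrib matrix_vector_mul_assoc
          matrix_mul_assoc add.assoc)
    then have "norm (E *v hidden_layers \<rho> Hs' (act \<rho> (A *v x + b)) - \<Lambda> y) < e / 2"
      using DE[OF B(2)[OF yC(1)]] by (simp add: \<Lambda>_def)
    moreover have "norm (\<Lambda> y - \<Lambda> (f x)) < e / 2"
      using uc[OF yC(2,1)] yf by (simp add: dist_norm)
    ultimately show ?thesis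
      using norm_triangle_ineq[of "E *v hidden_layers \<rho> Hs' (act \<rho> (A *v x + b)) - \<Lambda> y" "\<Lambda> y - \<Lambda> (f x)"] by simp
  qed
  then show "\<exists>(A :: complex ^ 'n ^ 'w) b Hs (M :: complex ^ 'w ^ 'w).
        \<forall>x\<in>K. norm (M *v hidden_layers \<rho> Hs (act \<rho> (A *v x + b)) - partial_act \<rho> I (T *v f x + t)) < e"
    unfolding \<Lambda>_def by blast
qed

text \<open>The neurons of a layer are organised as registers: the input, the partial sums of the
  output, and one cell evaluating the activation function.\<close>

context
  fixes h :: "('n::finite + 'm::finite) option \<Rightarrow> 'w::finite"
  assumes h: "bij h"
begin

definition pack :: "complex ^ 'n \<Rightarrow> complex ^ 'm \<Rightarrow> complex \<Rightarrow> complex ^ 'w" where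
  "pack x y t = (\<chi> k. case inv h k of None \<Rightarrow> t | Some (Inl i) \<Rightarrow> x $ i | Some (Inr j) \<Rightarrow> y $ j)"

lemma pack_nth [simp]:
  "pack x y t $ h None = t" "pack x y t $ h (Some (Inl i)) = x $ i" "pack x y t $ h (Some (Inr j)) = y $ j"
  using h by (simp_all add: pack_def bij_is_inj)

text \<open>Since \<open>h\<close> is onto, a state is determined by its registers; the matrix
  constructions can then be checked without meeting \<open>inv h\<close>.\<close>

lemma vec_eq_pack_iff:
  "v = pack x y t \<longleftrightarrow> v $ h None = t \<and> (\<forall>i. v $ h (Some (Inl i)) = x $ i) \<and> (\<forall>j. v $ h (Some (Inr j)) = y $ j)"
proof -
  have "(\<forall>k. v $ k = pack x y t $ k) \<longleftrightarrow> (\<forall>r. v $ h r = pack x y t $ h r)"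
    using h by (metis bij_pointE)
  also have "\<dots> \<longleftrightarrow> v $ h None = t \<and> (\<forall>i. v $ h (Some (Inl i)) = x $ i) \<and> (\<forall>j. v $ h (Some (Inr j)) = y $ j)"
    by (auto simp: split_option_all split_sum_all)
  finally show ?thesis by (simp add: vec_eq_iff)
qed

lemma continuous_on_pack:
  assumes "continuous_on S f" "continuous_on S g" "continuous_on S t"
  shows "continuous_on S (\<lambda>x. pack (f x) (g x) (t x))"
  unfolding pack_def
proof (rule continuous_on_vec_lambda)
  fix k
  show "continuous_on S (\<lambda>x. case inv h k of None \<Rightarrow> t x | Some (Inl i) \<Rightarrow> f x $ i | Some (Inr j) \<Rightarrow> g x $ j)"
    by (cases "inv h k"; (cases "the (inv h k)")?) (auto intro!: continuous_intros assms)
qed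

lemma exists_input_matrix:
  "\<exists>(A :: complex ^ 'n ^ 'w) c. \<forall>x. A *v x + c = pack x 0 (dotp a x + b)"
proof -
  let ?L = "\<lambda>x. pack x 0 (dotp a x)"
  have "Vector_Spaces.linear (*s) (*s) ?L"
    by (rule Vector_Spaces.linear_iff[THEN iffD2])
      (auto simp: vec_eq_pack_iff vec.vector_space_axioms sum.distrib dotp_def algebra_simps sum_distrib_left eq_commute[of "pack _ _ _"])
  then have "matrix ?L *v x = ?L x" for x by (rule matrix_works)
  then have "matrix ?L *v x + pack 0 0 b = pack x 0 (dotp a x + b)" for x
    by (simp add: vec_eq_pack_iff)
  then show ?thesis by blast
qed

text \<open>One affine map does two things at once: it adds the cell's value, weighted by
  \<open>\<alpha>\<close>, to the partial sums, and overwrites the cell with the next preactivation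
  computed from the stored input.\<close>

lemma exists_update_matrix:
  "\<exists>(T :: complex ^ 'w ^ 'w) c. \<forall>x y t. T *v pack x y t + c = pack x (y + t *s \<alpha>) (dotp a x + b)"
proof -
  define X where "X v = (\<chi> i. v $ h (Some (Inl i)))" for v :: "complex ^ 'w"
  define L where "L v = pack (X v) ((\<chi> j. v $ h (Some (Inr j))) + v $ h None *s \<alpha>) (dotp a (X v))" for v
  have "Vector_Spaces.linear (*s) (*s) L"
    by (rule Vector_Spaces.linear_iff[THEN iffD2])
      (auto simp: L_def X_def vec_eq_pack_iff vec.vector_space_axioms sum.distrib dotp_def algebra_simps sum_distrib_left eq_commute[of "pack _ _ _"])
  then have "matrix L *v v = L v" for v by (rule matrix_works)
  then have "matrix L *v pack x y t + pack 0 0 b = pack x (y + t *s \<alpha>) (dotp a x + b)" for x y t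
    by (simp add: vec_eq_pack_iff L_def X_def dotp_def)
  then show ?thesis by blast
qed

lemma exists_output_matrix: "\<exists>(C :: complex ^ 'w ^ 'm). \<forall>x y t. C *v pack x y t = y"
proof -
  define L where "L v = (\<chi> j. v $ h (Some (Inr j)))" for v :: "complex ^ 'w"
  have "Vector_Spaces.linear (*s) (*s) L"
    by (rule Vector_Spaces.linear_iff[THEN iffD2])
      (auto simp: L_def vec_eq_iff vec.vector_space_axioms)
  then have "matrix L *v v = L v" for v by (rule matrix_works)
  then have "matrix L *v pack x y t = y" for x y t
    by (simp add: vec_eq_iff L_def)
  then show ?thesis by blast
qed

end

section \<open>Simulating shallow networks by narrow ones\<close>

lemma continuous_on_vshallow:
  assumes "continuous_on UNIV \<rho>"
  shows "continuous_on S (vshallow \<rho> js)"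
proof -
  have "continuous_on S (\<lambda>x. vshallow \<rho> js x)"
  proof (induction js)
    case (Cons p js)
    obtain \<alpha> a b where p: "p = (\<alpha>, a, b)" by (cases p) auto
    have "continuous_on S (\<lambda>x. \<rho> (dotp a x + b))"
      by (intro continuous_on_compose2[OF assms] continuous_intros) auto
    then have "continuous_on S (\<lambda>x. \<rho> (dotp a x + b) *s \<alpha>)"
      unfolding vector_scalar_mult_def by (intro continuous_on_vec_lambda continuous_intros)
    then show ?case
      using Cons.IH by (simp add: vshallow_def p continuous_on_add)
  qed (simp add: vshallow_def)
  then show ?thesis by simp
qed

text \<open>The cell holds one activation not yet accumulated. Keeping its \<open>a\<close> and
  \<open>b\<close> arbitrary makes the induction work: the hypothesis is used with the parameters of
  the new term, which the update then adds while loading the next preactivation.\<close>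

lemma net_approximable_vshallow:
  fixes h :: "('n::finite + 'm::finite) option \<Rightarrow> 'w::finite" and js :: "((complex ^ 'm) \<times> (complex ^ 'n) \<times> complex) list"
  assumes h: "bij h" and id: "approximates_identity \<rho>" and cont: "continuous_on UNIV \<rho>"
  shows "net_approximable \<rho> (\<lambda>x. pack h x (vshallow \<rho> js x) (\<rho> (dotp a x + b)))"
proof (induction js arbitrary: a b)
  case Nil
  obtain A :: "complex ^ 'n ^ 'w" and c where A: "\<And>x. A *v x + c = pack h x 0 (dotp a x + b)"
    using exists_input_matrix[OF h] by blast
  have "net_approximable \<rho> (\<lambda>x. partial_act \<rho> {h None} (A *v x + c))"
    by (rule net_approximable_first_layer[OF id])
  moreover have "partial_act \<rho> {h None} (A *v x + c) = pack h x (vshallow \<rho> [] x) (\<rho> (dotp a x + b))" for x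
    unfolding A using h by (simp add: vec_eq_pack_iff[OF h] partial_act_def vshallow_def pack_nth[OF h] bij_is_inj inj_eq)
  ultimately show ?case by simp
next
  case (Cons p js)
  obtain \<alpha> a' b' where p: "p = (\<alpha>, a', b')" by (cases p) auto
  obtain T :: "complex ^ 'w ^ 'w" and c
    where T: "\<And>x (y :: complex ^ 'm) t. T *v pack h x y t + c = pack h x (y + t *s \<alpha>) (dotp a x + b)"
    using exists_update_matrix[OF h] by blast
  let ?f = "\<lambda>x. pack h x (vshallow \<rho> js x) (\<rho> (dotp a' x + b'))"
  have "continuous_on UNIV ?f"
    by (intro continuous_on_pack[OF h] continuous_on_vshallow continuous_on_compose2[OF cont] continuous_intros cont) auto
  then have "net_approximable \<rho> (\<lambda>x. partial_act \<rho> {h None} (T *v ?f x + c))"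
    by (rule net_approximable_next_layer[OF id cont Cons.IH])
  moreover have "partial_act \<rho> {h None} (T *v ?f x + c) = pack h x (vshallow \<rho> (p # js) x) (\<rho> (dotp a x + b))" for x
    unfolding T using h
    by (simp add: vec_eq_pack_iff[OF h] partial_act_def vshallow_def p pack_nth[OF h] bij_is_inj inj_eq add.commute)
  ultimately show ?case by simp
qed

theorem NN_universal:
  assumes \<rho>: "exp_growth \<rho>" "\<not> \<rho> differentiable (at 0)" and id: "approximates_identity \<rho>"
    and card: "CARD('w) = CARD('n) + CARD('m) + 1"
  shows "universal (NN \<rho> TYPE('w::finite) :: (complex ^ ('n::finite) \<Rightarrow> complex ^ ('m::finite)) set)"
  unfolding universal_def
proof (intro allI impI)
  fix g :: "complex ^ 'n \<Rightarrow> complex ^ 'm" and K :: "(complex ^ 'n) set" and e :: real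
  assume g: "continuous_on UNIV g" and K: "compact K" and e: "e > 0"
  have cont: "continuous_on UNIV \<rho>" using \<rho>(1) by (simp add: exp_growth_def)
  have "card (UNIV :: ('n + 'm) option set) = CARD('w)"
    by (simp add: card card_UNIV_option card_UNIV_sum)
  then obtain h :: "('n + 'm) option \<Rightarrow> 'w" where h: "bij h"
    using finite_same_card_bij[of "UNIV :: ('n + 'm) option set" "UNIV :: 'w set"] by auto
  obtain C :: "complex ^ 'w ^ 'm" where C: "\<And>x y t. C *v pack h x y t = y"
    using exists_output_matrix[OF h] by blast
  obtain k where k: "k > 0" "\<And>v. norm (C *v v) \<le> norm v * k"
    using bounded_linear.pos_bounded[OF bounded_linear_matrix_vector[of C]] by blast
  \<comment> \<open>The output map magnifies errors by at most \<open>k\<close>, so the simulation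
    may use \<open>e / (2 * k)\<close>; the rest is left for the shallow approximation.\<close>
  have e2: "e / 2 > 0" "e / (2 * k) > 0" using e k by auto
  obtain js where js: "\<And>x. x \<in> K \<Longrightarrow> norm (vshallow \<rho> js x - g x) < e / 2"
    using vshallow_dense[OF \<rho> g K e2(1)] by blast
  \<comment> \<open>The parameters 0 and 0 are a dummy load for the cell; \<open>C\<close> discards
    its content.\<close>
  define F where "F x = pack h x (vshallow \<rho> js x) (\<rho> (dotp 0 x + 0))" for x
  have "net_approximable \<rho> F"
    unfolding F_def by (rule net_approximable_vshallow[OF h id cont])
  from net_approximableD[OF this K e2(2)] obtain A :: "complex ^ 'n ^ 'w" and b Hs and M :: "complex ^ 'w ^ 'w"
    where net: "\<And>x. x \<in> K \<Longrightarrow> norm (M *v hidden_layers \<rho> Hs (act \<rho> (A *v x + b)) - F x) < e / (2 * k)"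
    by blast
  define f where "f x = (C ** M) *v hidden_layers \<rho> Hs (act \<rho> (A *v x + b)) + 0" for x
  have "f \<in> NN \<rho> TYPE('w)"
    unfolding NN_def f_def[abs_def] by blast
  moreover have "norm (f x - g x) < e" if x: "x \<in> K" for x
  proof -
    have "f x - vshallow \<rho> js x = C *v (M *v hidden_layers \<rho> Hs (act \<rho> (A *v x + b)) - F x)"
      by (simp add: f_def matrix_vector_mult_diff_distrib C F_def matrix_vector_mul_assoc)
    then have "norm (f x - vshallow \<rho> js x) \<le> norm (M *v hidden_layers \<rho> Hs (act \<rho> (A *v x + b)) - F x) * k"
      using k(2) by simp
    also have "\<dots> < e / (2 * k) * k"
      using net[OF x] k(1) by (intro mult_strict_right_mono)
    also have "\<dots> = e / 2" using k(1) by simp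
    finally show ?thesis
      using js[OF x] norm_triangle_ineq[of "f x - vshallow \<rho> js x" "vshallow \<rho> js x - g x"] by simp
  qed
  ultimately show "\<exists>f\<in>NN \<rho> TYPE('w). \<forall>x\<in>K. norm (f x - g x) < e" by (intro bexI[of _ f]) auto
qed

section \<open>The perturbed sine as an activation\<close>

lemma norm_sin_minus_self_le: "norm (sin z - z) \<le> (norm z)\<^sup>2 * exp (norm z)" for z :: complex
proof -
  have "sin z - z = ((exp (\<i> * z) - 1 - \<i> * z) - (exp (- (\<i> * z)) - 1 - (- (\<i> * z)))) / (2 * \<i>)"
    by (simp add: sin_exp_eq field_simps)
  then have "norm (sin z - z) = norm ((exp (\<i> * z) - 1 - \<i> * z) - (exp (- (\<i> * z)) - 1 - (- (\<i> * z)))) / 2"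
    by (simp add: norm_divide norm_mult)
  also have "\<dots> \<le> (norm (exp (\<i> * z) - 1 - \<i> * z) + norm (exp (- (\<i> * z)) - 1 - (- (\<i> * z)))) / 2"
    by (intro divide_right_mono norm_triangle_ineq4) simp
  also have "\<dots> \<le> ((norm z)\<^sup>2 * exp (norm z) + (norm z)\<^sup>2 * exp (norm z)) / 2"
    using norm_exp_minus_linear_le[of "\<i> * z"] norm_exp_minus_linear_le[of "- (\<i> * z)"]
    by (intro divide_right_mono add_mono) (simp_all add: norm_mult)
  finally show ?thesis by (simp add: mult.commute)
qed

text \<open>The map \<open>\<rho> (\<eta> * u + 2 * pi * N) / \<eta>\<close> is
  \<open>sin (\<eta> * u) / \<eta>\<close>, close to u for small \<eta>, plus a perturbation of size
  \<open>exp (- 2 * pi * N) / \<eta>\<close> up to a constant. Hence \<eta> is fixed before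
  N.\<close>

lemma sin_perturbation_approximates_identity:
  fixes w :: "complex \<Rightarrow> complex"
  assumes w: "bounded (range w)" and \<rho>: "\<And>z. \<rho> z = sin z + w z * exp (- z)"
  shows "approximates_identity \<rho>"
  unfolding approximates_identity_def
proof (intro allI impI)
  fix B e :: real assume B: "B > 0" and e: "e > 0"
  obtain M where M: "M > 0" "\<And>z. norm (w z) \<le> M"
    using w unfolding bounded_pos by auto
  \<comment> \<open>The linearisation error is at most \<open>\<eta> * (B^2 * exp B)\<close>, to be
    kept below \<open>e / 2\<close>; the cap 1 ensures \<open>norm v <= B\<close>, so that the
    exponential factor is at most \<open>exp B\<close>.\<close>
  define \<eta> where "\<eta> = min 1 (e / (2 * (B\<^sup>2 * exp B)))"
  have \<eta>: "0 < \<eta>" "\<eta> \<le> 1" using B e by (auto simp: \<eta>_def)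
  have \<eta>e: "\<eta> * (B\<^sup>2 * exp B) \<le> e / 2"
  proof -
    have "\<eta> * (B\<^sup>2 * exp B) \<le> e / (2 * (B\<^sup>2 * exp B)) * (B\<^sup>2 * exp B)"
      using B by (intro mult_right_mono) (auto simp: \<eta>_def)
    then show ?thesis using B by simp
  qed
  \<comment> \<open>The real part at the shifted point is at least \<open>2 * pi * n - B\<close>,
    which bounds the rescaled perturbation by this sequence.\<close>
  have "(\<lambda>n. (M * exp B / \<eta>) * exp (- (2 * pi)) ^ n) \<longlonglongrightarrow> (M * exp B / \<eta>) * 0"
    by (intro tendsto_mult tendsto_const LIMSEQ_power_zero) simp
  then have "\<forall>\<^sub>F n in sequentially. (M * exp B / \<eta>) * exp (- (2 * pi)) ^ n < e / 2"
    using e by (intro order_tendstoD) auto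
  then obtain N where N: "(M * exp B / \<eta>) * exp (- (2 * pi)) ^ N < e / 2"
    using eventually_happens'[OF sequentially_bot] by blast
  have N': "M * (exp B * exp (- (2 * pi * real N))) / \<eta> < e / 2"
    using N by (simp add: mult.commute flip: exp_of_nat_mult)
  have "norm (of_real (1 / \<eta>) * \<rho> (of_real \<eta> * u + of_real (2 * pi * real N)) - u) < e" if u: "norm u \<le> B" for u
  proof -
    define v where "v = of_real \<eta> * u"
    define s where "s = v + of_real (2 * pi * real N)"
    have nv: "norm v = \<eta> * norm u" using \<eta> by (simp add: v_def norm_mult)
    have nvB: "norm v \<le> \<eta> * B" using \<eta> u by (simp add: nv)
    then have nvB': "norm v \<le> B" using mult_right_mono[OF \<eta>(2), of B] B by linarith
    have trig: "sin (2 * pi * real N) = 0" "cos (2 * pi * real N) = 1"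
      using sin_2npi[of N] cos_2npi[of N] by (simp_all only: mult_ac)
    have sin: "sin s = sin v"
      unfolding s_def sin_add sin_of_real cos_of_real trig by simp
    have "norm (w s * exp (- s)) \<le> M * (exp B * exp (- (2 * pi * real N)))"
      unfolding norm_mult
    proof (rule mult_mono)
      have "- Re v \<le> B" using abs_Re_le_cmod[of v] nvB' by linarith
      then have "exp (Re (- s)) \<le> exp (B + - (2 * pi * real N))" by (simp add: s_def)
      then show "norm (exp (- s)) \<le> exp B * exp (- (2 * pi * real N))" by (simp only: exp_add norm_exp_eq_Re)
    qed (use M in auto)
    then have 1: "norm (w s * exp (- s)) / \<eta> \<le> M * (exp B * exp (- (2 * pi * real N))) / \<eta>"
      using \<eta> by (intro divide_right_mono) auto
    have "norm (sin v - v) \<le> (norm v)\<^sup>2 * exp (norm v)" by (rule norm_sin_minus_self_le)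
    also have "\<dots> \<le> (\<eta> * B)\<^sup>2 * exp B"
      using nvB nvB' by (intro mult_mono power_mono) auto
    finally have "norm (sin v - v) / \<eta> \<le> (\<eta> * B)\<^sup>2 * exp B / \<eta>"
      using \<eta> by (intro divide_right_mono) auto
    also have "\<dots> = \<eta> * (B\<^sup>2 * exp B)" using \<eta> by (simp add: power2_eq_square)
    finally have 2: "norm (sin v - v) / \<eta> \<le> e / 2" using \<eta>e by linarith
    have "of_real (1 / \<eta>) * \<rho> s - u = ((sin v - v) + w s * exp (- s)) / of_real \<eta>"
      unfolding \<rho> sin using \<eta> by (simp add: v_def field_simps)
    then have "norm (of_real (1 / \<eta>) * \<rho> s - u) = norm ((sin v - v) + w s * exp (- s)) / \<eta>"
      using \<eta> by (simp add: norm_divide)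
    also have "\<dots> \<le> (norm (sin v - v) + norm (w s * exp (- s))) / \<eta>"
      using \<eta> by (intro divide_right_mono norm_triangle_ineq) auto
    also have "\<dots> < e"
      unfolding add_divide_distrib using add_le_less_mono[OF 2 le_less_trans[OF 1 N']] by simp
    finally show ?thesis by (simp add: s_def v_def)
  qed
  then show "\<exists>\<alpha> \<beta> \<gamma>. \<forall>u. norm u \<le> B \<longrightarrow> norm (\<gamma> * \<rho> (\<alpha> * u + \<beta>) - u) < e"
    by (intro exI allI impI)
qed

lemma exp_growth_sin: "exp_growth sin"
proof (rule exp_growthI[where C = 1 and A = 1])
  fix z :: complex
  have "sin z = (exp (\<i> * z) - exp (- (\<i> * z))) / (2 * \<i>)" by (rule sin_exp_eq)
  then have "norm (sin z) = norm (exp (\<i> * z) - exp (- (\<i> * z))) / 2" by (simp add: norm_divide norm_mult)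
  also have "\<dots> \<le> (norm (exp (\<i> * z)) + norm (exp (- (\<i> * z)))) / 2"
    by (intro divide_right_mono norm_triangle_ineq4) simp
  also have "\<dots> \<le> (exp (norm z) + exp (norm z)) / 2"
    using norm_exp[of "\<i> * z"] norm_exp[of "- (\<i> * z)"]
    unfolding norm_minus_cancel norm_mult norm_ii mult_1
    by (rule divide_right_mono[OF add_mono]) simp
  finally show "norm (sin z) \<le> 1 * exp (1 * norm z)" by simp
qed (intro continuous_intros)

lemma sin_perturbation_exp_growth:
  assumes "continuous_on UNIV w" "bounded (range w)"
  shows "exp_growth (\<lambda>z. sin z + w z * exp (- z))"
proof -
  obtain M where M: "M > 0" "\<And>z. norm (w z) \<le> M"
    using assms(2) unfolding bounded_pos by auto
  have "exp_growth w"
    by (rule exp_growthI[where C = M and A = 0]) (use assms(1) M in auto)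
  moreover have "exp_growth (\<lambda>z. exp (- z))"
    by (rule exp_growth_exp[where A = 1]) (auto intro!: continuous_intros)
  ultimately show ?thesis
    by (intro exp_growth_add exp_growth_mult exp_growth_sin)
qed

theorem theorem6p5:
  fixes w :: "complex \<Rightarrow> complex" and \<rho> :: "complex \<Rightarrow> complex"
  assumes "continuous_on UNIV w"
    and "bounded (range w)"
    and "nowhere_real_differentiable w"
    and "\<And>z. \<rho> z = sin z + w z * exp (- z)"
    and "CARD('w) = CARD('n) + CARD('m) + 1"
  shows "nowhere_real_differentiable \<rho> \<and>
         universal (NN \<rho> TYPE('w::finite) :: (complex ^ ('n::finite) \<Rightarrow> complex ^ ('m::finite)) set)"
proof -
  have nd: "\<not> \<rho> differentiable (at z)" for z
  proof
    assume "\<rho> differentiable (at z)"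
    moreover have hol: "f differentiable (at z)" if "f field_differentiable (at z)" for f :: "complex \<Rightarrow> complex"
      using that by (rule field_differentiable_imp_differentiable)
    have "sin differentiable (at z)" "exp differentiable (at z)"
      by (intro hol field_differentiable_at_sin field_differentiable_within_exp)+
    \<comment> \<open>Solving for \<open>w\<close>: as \<open>exp z\<close> inverts
      \<open>exp (- z)\<close>, differentiability of \<rho> at one point would pass to
      \<open>w\<close>.\<close>
    ultimately have "(\<lambda>z. (\<rho> z - sin z) * exp z) differentiable (at z)"
      by (intro differentiable_mult differentiable_diff)
    moreover have "(\<lambda>z. (\<rho> z - sin z) * exp z) = w"
      by (simp add: assms(4) fun_eq_iff mult.assoc flip: exp_add)
    ultimately show False
      using assms(3) by (simp add: nowhere_real_differentiable_def real_differentiable_at_iff)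
  qed
  have "\<rho> = (\<lambda>z. sin z + w z * exp (- z))" using assms(4) by auto
  then have "exp_growth \<rho>" using sin_perturbation_exp_growth[OF assms(1,2)] by simp
  then have "universal (NN \<rho> TYPE('w) :: (complex ^ 'n \<Rightarrow> complex ^ 'm) set)"
    by (rule NN_universal[OF _ nd sin_perturbation_approximates_identity[OF assms(2,4)] assms(5)])
  then show ?thesis
    using nd by (simp add: nowhere_real_differentiable_def real_differentiable_at_iff)
qed

end
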